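(* Let $a<b$ be real numbers and let $f:[a,b]\to\mathbb{R}$ be a $C^1$ function with strictly monotone derivative; let $\Phi_\alpha$ ($\alpha\in\mathbb{R}$) be the associated maps defined in the context. For each $\alpha\in\mathbb{R}$, suppose $W_\alpha\subset\mathbb{R}$ is such that $\bigcup_{\alpha}(\{\alpha\}\times W_\alpha)\subset\mathbb{R}^2$ is Lebesgue measurable. Then there exists a set $E\subset\mathbb{R}^2$ such that for almost every $\alpha\in\mathbb{R}$, (a) $\Phi_\alpha(E)\supset W_\alpha$, (b) $|\Phi_\alpha(E)\setminus W_\alpha|=0$.
   Context: For $\alpha\in\mathbb{R}$, $\operatorname{dom}\Phi_\alpha=[\alpha-b,\alpha-a]\times\mathbb{R}$ and $\Phi_\alpha:\operatorname{dom}\Phi_\alpha\to\mathbb{R}$ is given by $\Phi_\alpha(x_1,x_2)=x_2+f(\alpha-x_1)$ (the vertical line $\{\alpha\}\times\mathbb{R}$ is identified with $\mathbb{R}$; equivalently $(\alpha,\Phi_\alpha(x))$ is the unique intersection point of the translated graph $x+\Gamma$, $\Gamma=\{(t,f(t)):t\in[a,b]\}$, with the line $\{\alpha\}\times\mathbb{R}$). For an arbitrary set $E\subset\mathbb{R}^2$, $\Phi_\alpha(E)$ means $\Phi_\alpha(E\cap\operatorname{dom}\Phi_\alpha)$. $|\cdot|$ is one-dimensional Lebesgue measure. *)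

theory Defs
  imports "HOL-Analysis.Analysis"
begin

text \<open>
  The function \<open>f\<close> on \<open>[a, b]\<close> is represented by a total function whose values outside
  \<open>[a, b]\<close> play no role: \<open>x \<in> dom_Phi a b \<alpha>\<close> is equivalent to \<open>\<alpha> - fst x \<in> {a..b}\<close>.
\<close>

definition dom_Phi :: "real \<Rightarrow> real \<Rightarrow> real \<Rightarrow> (real \<times> real) set" where
  "dom_Phi a b \<alpha> = {\<alpha> - b..\<alpha> - a} \<times> UNIV"

definition Phi :: "(real \<Rightarrow> real) \<Rightarrow> real \<Rightarrow> real \<times> real \<Rightarrow> real" where
  "Phi f \<alpha> x = snd x + f (\<alpha> - fst x)"

definition Phi_image ::
    "real \<Rightarrow> real \<Rightarrow> (real \<Rightarrow> real) \<Rightarrow> real \<Rightarrow> (real \<times> real) set \<Rightarrow> real set" where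
  "Phi_image a b f \<alpha> E = Phi f \<alpha> ` (E \<inter> dom_Phi a b \<alpha>)"

end

theory Submission imports Defs begin

text \<open>
  Encode the translate \<open>x + \<Gamma>\<close> of the graph as the point \<open>x\<close> of the plane, so that \<open>Phi F \<alpha> x\<close> is the height of the
  translate over \<open>\<alpha>\<close>. All translates passing through one point over \<open>\<beta>\<close> form a curve (\<open>fan\<close>) in the
  plane of parameters, whose image under \<open>Phi F \<beta>\<close> is a single point. Since \<open>F'\<close> is monotone, replacing
  a fan over \<open>\<beta>\<close> by many short fans over a slightly larger \<open>\<beta>'\<close>, with the same starting points and
  the same ranges of the first coordinate, only enlarges the images for \<open>\<alpha> \<le> \<beta>\<close>. Sweeping \<open>\<beta>\<close> over an
  interval in small steps (a Venetian blind construction) therefore yields parameter sets whose images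
  still cover over a given window while their area outside the window is as small as we please;
  inside the window it is controlled by staying close to the original set. Passing to a \<open>G\<^sub>\<delta>\<close> hull \<open>\<Inter>\<^sub>k G\<^sub>k\<close> of the target and
  refining inside \<open>G\<^sub>0, G\<^sub>1, \<dots>\<close> successively, the limit set is found by compactness, and Fubini
  turns the vanishing of areas into the statement for almost every \<open>\<alpha>\<close>.
\<close>

subsection \<open>Strips swept out by sets of translates\<close>

definition strip :: "(real \<Rightarrow> real) \<Rightarrow> real set \<Rightarrow> (real \<times> real) set \<Rightarrow> (real \<times> real) set" where
  "strip F I S = (SIGMA \<alpha>:I. Phi F \<alpha> ` S)"

text \<open>A triple \<open>(x, y, z)\<close> with \<open>z < y\<close> encodes the empty set, so a
  segment can be cut down to an intersection of height ranges without a case distinction.\<close>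

definition vseg :: "real \<times> real \<times> real \<Rightarrow> (real \<times> real) set" where
  "vseg v = {fst v} \<times> {fst (snd v)..snd (snd v)}"

definition vsegs :: "(real \<times> real) set \<Rightarrow> bool" where
  "vsegs K \<longleftrightarrow> (\<exists>T. finite T \<and> K = \<Union> (vseg ` T))"

lemma vseg_simp [simp]: "vseg (x, y, z) = {x} \<times> {y..z}"
  by (simp add: vseg_def)

lemma compact_vseg [simp]: "compact (vseg v)"
  by (simp add: vseg_def compact_Times)

lemma vsegs_vseg: "vsegs (vseg v)"
  unfolding vsegs_def by (rule exI[of _ "{v}"]) auto

lemma vsegs_empty [simp]: "vsegs {}"
  unfolding vsegs_def by (rule exI[of _ "{}"]) auto

lemma vsegs_Un: "vsegs K \<Longrightarrow> vsegs L \<Longrightarrow> vsegs (K \<union> L)"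
  unfolding vsegs_def by (metis finite_UnI image_Un Union_Un_distrib)

lemma vsegs_UN: "finite I \<Longrightarrow> (\<And>i. i \<in> I \<Longrightarrow> vsegs (K i)) \<Longrightarrow> vsegs (\<Union>i\<in>I. K i)"
  by (induction I rule: finite_induct) (auto intro: vsegs_Un)

lemma vsegs_compact: "vsegs K \<Longrightarrow> compact K"
  unfolding vsegs_def by (force intro!: compact_UN compact_vseg simp del: vseg_simp)

lemma Phi_Pair [simp]: "Phi F \<alpha> (x, y) = y + F (\<alpha> - x)"
  by (simp add: Phi_def)

lemma Phi_image_vseg: "Phi F \<alpha> ` ({x} \<times> {y..z}) = {y + F (\<alpha> - x)..z + F (\<alpha> - x)}"
proof -
  have "{x} \<times> {y..z} = Pair x ` {y..z}" by auto
  then show ?thesis by (simp add: image_image)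
qed

lemma strip_mono: "I \<subseteq> J \<Longrightarrow> S \<subseteq> T \<Longrightarrow> strip F I S \<subseteq> strip F J T"
  unfolding strip_def by (intro Sigma_mono image_mono) auto

lemma strip_UN: "strip F I (\<Union>j\<in>J. S j) = (\<Union>j\<in>J. strip F I (S j))"
  unfolding strip_def by auto

lemma strip_Un: "strip F I (S \<union> T) = strip F I S \<union> strip F I T"
  unfolding strip_def by auto

lemma strip_Un_left: "strip F (I \<union> J) S = strip F I S \<union> strip F J S"
  unfolding strip_def by auto

lemma strip_empty [simp]: "strip F I {} = {}" "strip F {} S = {}"
  unfolding strip_def by auto

lemma strip_eq_image: "strip F I S = (\<lambda>p. (fst p, Phi F (fst p) (snd p))) ` (I \<times> S)"
  unfolding strip_def by force

section \<open>Topology, measurability and area of strips\<close>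

lemma continuous_Phi:
  assumes "continuous_on UNIV F"
  shows "continuous_on UNIV (\<lambda>p. (fst p, Phi F (fst p) (snd p)))"
  unfolding Phi_def
  by (intro continuous_intros continuous_on_compose2[OF assms]) auto

lemma compact_strip:
  assumes "continuous_on UNIV F" "compact I" "compact S"
  shows "compact (strip F I S)"
  unfolding strip_eq_image
  using assms continuous_Phi[OF assms(1)]
  by (intro compact_continuous_image compact_Times) (auto intro: continuous_on_subset)

lemma compact_strip_borel:
  assumes "continuous_on UNIV F" "compact I" "compact S"
  shows "strip F I S \<in> sets borel"
  using compact_strip[OF assms] by (simp add: borel_compact)

lemma open_strip:
  assumes "continuous_on UNIV F" "open U"
  shows "open (strip F UNIV U)"
proof -
  \<comment> \<open>Solving \<open>v = y + F (\<alpha> - x)\<close> for \<open>y\<close> shows that,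
    for fixed \<open>x\<close>, the corresponding part of the strip is a preimage of
    \<open>U\<close> under a continuous map.\<close>
  have "strip F UNIV U = (\<Union>x. (\<lambda>p. (x, snd p - F (fst p - x))) -` U)"
  proof (intro set_eqI iffI)
    fix p assume "p \<in> strip F UNIV U"
    then obtain \<alpha> x y where "p = (\<alpha>, y + F (\<alpha> - x))" "(x, y) \<in> U"
      unfolding strip_def by auto
    then have "p \<in> (\<lambda>p. (x, snd p - F (fst p - x))) -` U" by simp
    then show "p \<in> (\<Union>x. (\<lambda>p. (x, snd p - F (fst p - x))) -` U)" by blast
  next
    fix p assume "p \<in> (\<Union>x. (\<lambda>p. (x, snd p - F (fst p - x))) -` U)"
    then obtain x where "(x, snd p - F (fst p - x)) \<in> U" by auto
    then have "Phi F (fst p) (x, snd p - F (fst p - x)) \<in> Phi F (fst p) ` U" by (rule imageI)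
    then show "p \<in> strip F UNIV U" unfolding strip_def by (cases p) auto
  qed
  moreover have "open ((\<lambda>p. (x, snd p - F (fst p - x))) -` U)" for x
    by (intro open_vimage assms continuous_intros continuous_on_compose2[OF assms(1)]) auto
  ultimately show ?thesis by auto
qed

lemma strip_borel:
  assumes "continuous_on UNIV F" "open U" "I \<in> sets borel"
  shows "strip F I U \<in> sets borel"
proof -
  have "strip F I U = strip F UNIV U \<inter> I \<times> UNIV" unfolding strip_def by auto
  moreover have "I \<times> UNIV \<in> sets (borel :: (real \<times> real) measure)"
    using assms(3) by (simp add: borel_prod[symmetric])
  ultimately show ?thesis using open_strip[OF assms(1,2)] by auto
qed

text \<open>Tube lemma. The parameters whose curve leaves \<open>P\<close> somewhere over
  \<open>I\<close> form the projection of a closed set along the compact factor \<open>I\<close>;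
  this projection is closed, and \<open>O'\<close> is its complement.\<close>

lemma tube_strip:
  assumes F: "continuous_on UNIV F" and I: "compact I" and P: "open P" and K: "strip F I K \<subseteq> P"
  obtains O' where "open O'" "K \<subseteq> O'" "strip F I O' \<subseteq> P"
proof
  define T where "T = (\<lambda>p. (fst p, Phi F (fst p) (snd p))) -` (- P)"
  have "closed T" unfolding T_def using P by (intro closed_vimage continuous_Phi F) auto
  then have "closed {y. \<exists>x. x \<in> I \<and> (x, y) \<in> T}" by (rule closed_compact_projection[OF I])
  then show "open (- {y. \<exists>x. x \<in> I \<and> (x, y) \<in> T})" by (rule open_Compl)
  show "K \<subseteq> - {y. \<exists>x. x \<in> I \<and> (x, y) \<in> T}" using K unfolding T_def strip_def by auto
  show "strip F I (- {y. \<exists>x. x \<in> I \<and> (x, y) \<in> T}) \<subseteq> P" unfolding T_def strip_def by auto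
qed

text \<open>Outer regularity puts the strip into an open set of area still below \<open>m\<close>,
  and the tube lemma pulls that set back to the parameters. An area bound obtained once thereby
  survives all later changes made inside \<open>O'\<close>.\<close>

lemma thicken_strip:
  assumes F: "continuous_on UNIV F" and I: "compact I" and K: "compact K" "K \<subseteq> U" "open U"
    and m: "emeasure lborel (strip F I K) < ennreal m"
  obtains O' where "open O'" "K \<subseteq> O'" "O' \<subseteq> U" "emeasure lborel (strip F I O') < ennreal m"
proof -
  let ?S = "strip F I K"
  have S: "?S \<in> sets borel" by (rule compact_strip_borel[OF F I K(1)])
  obtain c where c: "emeasure lborel ?S = ennreal c" "0 \<le> c" "c < m"
    using m by (cases "emeasure lborel ?S") (auto simp: ennreal_less_iff)
  obtain P where P: "open P" "?S \<subseteq> P" "emeasure lborel (P - ?S) < ennreal (m - c)"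
    using outer_regular_lborel[OF S, of "m - c"] c by auto
  have "emeasure lborel P = emeasure lborel ?S + emeasure lborel (P - ?S)"
    using P S by (subst plus_emeasure) (auto simp: Un_absorb1)
  also have "\<dots> < ennreal c + ennreal (m - c)"
    using P(3) c by (simp add: ennreal_add_left_cancel_less)
  also have "\<dots> = ennreal m" using c by (simp flip: ennreal_plus)
  finally have Pm: "emeasure lborel P < ennreal m" .
  obtain O' where O: "open O'" "K \<subseteq> O'" "strip F I O' \<subseteq> P"
    using tube_strip[OF F I P(1,2)] by blast
  show ?thesis
  proof (rule that[of "O' \<inter> U"])
    have "emeasure lborel (strip F I (O' \<inter> U)) \<le> emeasure lborel P"
      using O(3) strip_mono[of I I "O' \<inter> U" O' F] P(1) by (intro emeasure_mono) auto
    then show "emeasure lborel (strip F I (O' \<inter> U)) < ennreal m" using Pm by simp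
  qed (use O K in auto)
qed

text \<open>By Fubini the area is the integral of the slice lengths, each of which is at most
  \<open>w\<close>.\<close>

lemma emeasure_strip_le:
  assumes F: "continuous_on UNIV F" and K: "compact K" and "p \<le> q" "0 \<le> w"
    and slice: "\<And>\<alpha>. \<alpha> \<in> {p..q} \<Longrightarrow> \<exists>c. Phi F \<alpha> ` K \<subseteq> {c..c + w}"
  shows "emeasure lborel (strip F {p..q} K) \<le> ennreal ((q - p) * w)"
proof -
  let ?S = "strip F {p..q} K"
  have S: "?S \<in> sets (lborel \<Otimes>\<^sub>M lborel)"
    using compact_strip_borel[OF F _ K, of "{p..q}"] unfolding lborel_prod by simp
  have "emeasure lborel ?S = (\<integral>\<^sup>+\<alpha>. emeasure lborel (Pair \<alpha> -` ?S) \<partial>lborel)"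
    using lborel.emeasure_pair_measure_alt[OF S] by (simp add: lborel_prod)
  also have "\<dots> \<le> (\<integral>\<^sup>+\<alpha>. ennreal w * indicator {p..q} \<alpha> \<partial>lborel)"
  proof (rule nn_integral_mono)
    fix \<alpha> :: real
    show "emeasure lborel (Pair \<alpha> -` ?S) \<le> ennreal w * indicator {p..q} \<alpha>"
    proof (cases "\<alpha> \<in> {p..q}")
      case True
      then obtain c where c: "Phi F \<alpha> ` K \<subseteq> {c..c + w}" using slice by blast
      have "emeasure lborel (Pair \<alpha> -` ?S) \<le> emeasure lborel {c..c + w}"
        using c by (intro emeasure_mono) (auto simp: strip_def)
      then show ?thesis using True \<open>0 \<le> w\<close> by simp
    next
      case False
      then have "Pair \<alpha> -` ?S = {}" by (auto simp: strip_def)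
      then show ?thesis by simp
    qed
  qed
  also have "\<dots> = ennreal ((q - p) * w)"
    using assms(3,4) by (simp add: nn_integral_cmult_indicator ennreal_mult' mult.commute)
  finally show ?thesis .
qed

lemma emeasure_countable_UN_le:
  assumes P: "countable P" and X: "\<And>n. n \<in> P \<Longrightarrow> X n \<in> sets M" and e: "0 \<le> e"
    and le: "\<And>n. n \<in> P \<Longrightarrow> emeasure M (X n) \<le> ennreal (e * (1/2) ^ Suc (to_nat_on P n))"
  shows "emeasure M (\<Union>n\<in>P. X n) \<le> ennreal e"
proof -
  \<comment> \<open>Indices that enumerate no element of \<open>P\<close> receive the empty set, so
    finite and infinite \<open>P\<close> are treated alike.\<close>
  define Y where "Y i = (if i \<in> to_nat_on P ` P then X (from_nat_into P i) else {})" for i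
  have Y: "range Y \<subseteq> sets M" unfolding Y_def using X P by auto
  have Yle: "emeasure M (Y i) \<le> ennreal (e * (1/2) ^ Suc i)" for i
    unfolding Y_def using le P by auto
  have "(\<Union>n\<in>P. X n) = (\<Union>i. Y i)"
    unfolding Y_def using P by (auto split: if_splits) 
  then have "emeasure M (\<Union>n\<in>P. X n) \<le> (\<Sum>i. emeasure M (Y i))"
    using emeasure_subadditive_countably[OF Y] by simp
  also have "\<dots> \<le> (\<Sum>i. ennreal (e * (1/2) ^ Suc i))"
    by (intro suminf_le Yle) auto
  also have "\<dots> = ennreal e"
    using sums_mult[OF power_half_series, of e] e by (intro suminf_ennreal_eq) auto
  finally show ?thesis .
qed

subsection \<open>Sweeping fans of translates\<close>

lemma subdivide_interval:
  fixes s t x :: real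
  assumes "x \<in> {s..t}" "0 < n"
  obtains i where "i < n" "x \<in> {s + real i * ((t - s) / real n)..s + real (Suc i) * ((t - s) / real n)}"
proof -
  define h where "h = (t - s) / real n"
  have nh: "real n * h = t - s" using assms(2) by (simp add: h_def)
  have "\<exists>i<n. x \<in> {s + real i * h..s + real (Suc i) * h}" if "x \<le> s + real n * h" "0 < n" for n
    using that
  proof (induction n)
    case (Suc n)
    show ?case
    proof (cases "0 < n \<and> x \<le> s + real n * h")
      case True
      then show ?thesis using Suc.IH less_Suc_eq by blast
    next
      case False
      then have "s + real n * h \<le> x" using assms(1) by auto
      then show ?thesis using Suc.prems by auto
    qed
  qed simp
  from this[of n] obtain i where "i < n" "x \<in> {s + real i * h..s + real (Suc i) * h}"
    using nh assms by auto
  then show ?thesis using that unfolding h_def by blast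
qed

lemma ex_small_fraction:
  fixes c d :: real
  assumes "0 < d"
  obtains n :: nat where "0 < n" "c / real n \<le> d"
proof -
  obtain n :: nat where "c / d < real n" using reals_Archimedean2 by blast
  then have "c / real (Suc n) \<le> d"
    using assms by (simp add: field_simps)
  then show ?thesis using that[of "Suc n"] by simp
qed

locale convex_curve =
  fixes F F' :: "real \<Rightarrow> real"
  assumes deriv: "\<And>x. (F has_real_derivative F' x) (at x)"
    and cont_deriv: "continuous_on UNIV F'"
    and mono_deriv: "strict_mono F'"
begin

text \<open>The translates through the point over \<open>\<beta>\<close> that is met by the translate \<open>(s, z)\<close>.\<close>

definition fan :: "real \<Rightarrow> real \<Rightarrow> real \<Rightarrow> real \<Rightarrow> (real \<times> real) set" where
  "fan \<beta> s t z = (\<lambda>x. (x, z + F (\<beta> - s) - F (\<beta> - x))) ` {s..t}"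

section \<open>Images and areas of fans\<close>

lemma cont: "continuous_on UNIV F"
  using deriv by (auto intro!: DERIV_isCont continuous_at_imp_continuous_on)

lemma cont_reflect: "continuous_on S (\<lambda>x. F (\<alpha> - x))"
  by (intro continuous_on_compose2[OF cont] continuous_intros) auto

lemma mono_D: "x \<le> y \<Longrightarrow> F' x \<le> F' y"
  using mono_deriv by (simp add: strict_mono_less_eq)

text \<open>The mean value theorem for \<open>F (\<alpha> - x) - F (\<beta> - x)\<close> as a
  function of \<open>x\<close>. It ties the spread over \<alpha> of translates that meet over
  \<beta> to an increment of \<open>F'\<close>, and is the source of all upper and lower bounds for
  fans.\<close>

lemma increment_mvt:
  assumes "s \<le> t"
  obtains \<xi> where "\<xi> \<in> {s..t}"
    "(F (\<alpha> - t) - F (\<beta> - t)) - (F (\<alpha> - s) - F (\<beta> - s)) = (t - s) * (F' (\<beta> - \<xi>) - F' (\<alpha> - \<xi>))"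
proof (cases "s < t")
  case True
  have "((\<lambda>x. F (\<alpha> - x) - F (\<beta> - x)) has_real_derivative F' (\<beta> - x) - F' (\<alpha> - x)) (at x)" for x
    by (auto intro!: derivative_eq_intros deriv DERIV_chain2[OF deriv])
  then obtain \<xi> where "s < \<xi>" "\<xi> < t"
    "(F (\<alpha> - t) - F (\<beta> - t)) - (F (\<alpha> - s) - F (\<beta> - s)) = (t - s) * (F' (\<beta> - \<xi>) - F' (\<alpha> - \<xi>))"
    using MVT2[OF True, of "\<lambda>x. F (\<alpha> - x) - F (\<beta> - x)" "\<lambda>x. F' (\<beta> - x) - F' (\<alpha> - x)"] by auto
  then show ?thesis using that[of \<xi>] by auto
qed (use assms that[of s] in auto)

lemma increment_mono:
  assumes "\<alpha> \<le> \<beta>" "s \<le> t"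
  shows "F (\<alpha> - s) - F (\<beta> - s) \<le> F (\<alpha> - t) - F (\<beta> - t)"
proof -
  obtain \<xi> where "(F (\<alpha> - t) - F (\<beta> - t)) - (F (\<alpha> - s) - F (\<beta> - s)) = (t - s) * (F' (\<beta> - \<xi>) - F' (\<alpha> - \<xi>))"
    using increment_mvt[OF assms(2)] by blast
  moreover have "0 \<le> (t - s) * (F' (\<beta> - \<xi>) - F' (\<alpha> - \<xi>))"
    using assms mono_D[of "\<alpha> - \<xi>" "\<beta> - \<xi>"] by auto
  ultimately show ?thesis by linarith
qed

lemma compact_fan: "compact (fan \<beta> s t z)"
  unfolding fan_def
  by (intro compact_continuous_image continuous_intros cont_reflect) auto

text \<open>Along the fan the height over \<alpha> is continuous and nondecreasing in the first
  coordinate, so its values fill the interval between those at \<open>s\<close> and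
  \<open>t\<close>.\<close>

lemma Phi_image_fan:
  assumes "\<alpha> \<le> \<beta>" "s \<le> t"
  shows "Phi F \<alpha> ` fan \<beta> s t z = {z + F (\<alpha> - s)..z + F (\<beta> - s) + (F (\<alpha> - t) - F (\<beta> - t))}"
proof -
  let ?g = "\<lambda>x. z + F (\<beta> - s) + (F (\<alpha> - x) - F (\<beta> - x))"
  have "Phi F \<alpha> ` fan \<beta> s t z = ?g ` {s..t}"
    unfolding fan_def image_image by (intro image_cong) auto
  also have "\<dots> = {?g s..?g t}"
  proof (intro equalityI subsetI)
    fix v assume "v \<in> ?g ` {s..t}"
    then show "v \<in> {?g s..?g t}" using increment_mono[OF assms(1)] by fastforce
  next
    fix v assume v: "v \<in> {?g s..?g t}"
    have "continuous_on {s..t} ?g" by (intro continuous_intros cont_reflect)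
    then obtain x where "s \<le> x" "x \<le> t" "?g x = v"
      using IVT'[of ?g s v t] v assms(2) by auto
    then show "v \<in> ?g ` {s..t}" by auto
  qed
  finally show ?thesis by simp
qed

text \<open>Both images start at the height of the translate \<open>(s, z)\<close>, and moving the
  common point from \<beta> to \<open>\<beta>'\<close> only raises the upper end. This is why a fan
  can be turned to the right without losing coverage on the left.\<close>

lemma Phi_image_fan_mono:
  assumes "\<alpha> \<le> \<beta>" "\<beta> \<le> \<beta>'" "s \<le> t"
  shows "Phi F \<alpha> ` fan \<beta> s t z \<subseteq> Phi F \<alpha> ` fan \<beta>' s t z"
  using assms increment_mono[OF assms(2,3)]
  by (subst (1 2) Phi_image_fan) auto

text \<open>All members meet over \<beta>, and by the mean value theorem their spread over a nearby
  \<alpha> is at most the length \<open>t - s\<close> times an increment of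
  \<open>F'\<close>.\<close>

lemma fan_area:
  assumes "\<beta> \<le> \<beta>'" "s \<le> t" "0 \<le> w"
    and "\<And>\<alpha> x. \<alpha> \<in> {\<beta>..\<beta>'} \<Longrightarrow> x \<in> {s..t} \<Longrightarrow> F' (\<alpha> - x) - F' (\<beta> - x) \<le> w"
  shows "emeasure lborel (strip F {\<beta>..\<beta>'} (fan \<beta> s t z)) \<le> ennreal ((\<beta>' - \<beta>) * ((t - s) * w))"
proof (rule emeasure_strip_le[OF cont compact_fan assms(1)])
  fix \<alpha> assume \<alpha>: "\<alpha> \<in> {\<beta>..\<beta>'}"
  have "Phi F \<alpha> ` fan \<beta> s t z \<subseteq> {z + F (\<alpha> - s) - (t - s) * w..z + F (\<alpha> - s)}"
  proof
    fix v assume "v \<in> Phi F \<alpha> ` fan \<beta> s t z"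
    then obtain x where x: "x \<in> {s..t}" and v: "v = z + F (\<beta> - s) - F (\<beta> - x) + F (\<alpha> - x)"
      unfolding fan_def by auto
    obtain \<xi> where \<xi>: "\<xi> \<in> {s..x}" and
      "(F (\<beta> - x) - F (\<alpha> - x)) - (F (\<beta> - s) - F (\<alpha> - s)) = (x - s) * (F' (\<alpha> - \<xi>) - F' (\<beta> - \<xi>))"
      using increment_mvt[of s x \<beta> \<alpha>] x by auto
    moreover have "(x - s) * (F' (\<alpha> - \<xi>) - F' (\<beta> - \<xi>)) \<le> (t - s) * w"
      using x \<xi> assms(3) assms(4)[OF \<alpha>, of \<xi>] mono_D[of "\<beta> - \<xi>" "\<alpha> - \<xi>"] \<alpha>
      by (intro mult_mono) auto
    moreover have "F (\<beta> - s) - F (\<alpha> - s) \<le> F (\<beta> - x) - F (\<alpha> - x)"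
      using increment_mono[of \<beta> \<alpha> s x] \<alpha> x by auto
    ultimately show "v \<in> {z + F (\<alpha> - s) - (t - s) * w..z + F (\<alpha> - s)}" using v by auto
  qed
  then show "\<exists>c. Phi F \<alpha> ` fan \<beta> s t z \<subseteq> {c..c + (t - s) * w}"
    by (intro exI[of _ "z + F (\<alpha> - s) - (t - s) * w"]) auto
qed (use assms in auto)

text \<open>Uniform continuity of \<open>F\<close> gives one admissible length \<open>d\<close> for
  all starting points in the compact set \<open>K\<close>.\<close>

lemma short_fan_subset:
  assumes K: "compact K" "K \<subseteq> U" "open U"
  obtains d where "0 < d" "\<And>s t z. (s, z) \<in> K \<Longrightarrow> t \<le> s + d \<Longrightarrow> fan \<beta> s t z \<subseteq> U"
proof -
  obtain e where e: "0 < e" "(\<Union>k\<in>K. ball k e) \<subseteq> U"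
    using compact_subset_open_imp_ball_epsilon_subset[OF K(1) K(3) K(2)] by blast
  obtain B where B: "\<And>k. k \<in> K \<Longrightarrow> norm k \<le> B"
    using compact_imp_bounded[OF K(1)] by (auto simp: bounded_iff)
  \<comment> \<open>This interval contains every \<open>\<beta> - x\<close> that occurs: starting
    points have modulus at most \<open>B\<close>, and the margin 1 on the left allows for fans of
    length at most 1.\<close>
  have "uniformly_continuous_on {\<beta> - B - 1..\<beta> + B} F"
    by (intro compact_uniformly_continuous continuous_on_subset[OF cont]) auto
  then obtain d0 where d0: "0 < d0"
    "\<And>x y. x \<in> {\<beta> - B - 1..\<beta> + B} \<Longrightarrow> y \<in> {\<beta> - B - 1..\<beta> + B} \<Longrightarrow> dist x y < d0 \<Longrightarrow> dist (F x) (F y) < e / 2"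
    unfolding uniformly_continuous_on_def using e(1) by (metis half_gt_zero)
  define d where "d = Min {d0 / 2, 1, e / 3}"
  have d: "0 < d" "d \<le> d0 / 2" "d \<le> 1" "d \<le> e / 3" using d0(1) e(1) by (auto simp: d_def)
  show ?thesis
  proof (rule that[OF d(1)], rule subsetI)
    fix s t z p assume sz: "(s, z) \<in> K" and t: "t \<le> s + d" and "p \<in> fan \<beta> s t z"
    then obtain x where x: "s \<le> x" "x \<le> t" and p: "p = (x, z + F (\<beta> - s) - F (\<beta> - x))"
      unfolding fan_def by auto
    have "\<bar>s\<bar> \<le> B" using B[OF sz] norm_fst_le[of s z] by simp
    then have "dist (F (\<beta> - s)) (F (\<beta> - x)) < e / 2"
      using x t d by (intro d0(2)) (auto simp: dist_real_def)
    moreover have "dist s x < e / 2" using x t d e(1) by (auto simp: dist_real_def)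
    moreover have "dist (s, z) p \<le> dist s x + dist (F (\<beta> - s)) (F (\<beta> - x))"
      using norm_Pair_le[of "s - x" "F (\<beta> - x) - F (\<beta> - s)"]
      by (simp add: p dist_norm norm_minus_commute)
    ultimately have "p \<in> ball (s, z) e" by simp
    then show "p \<in> U" using e(2) sz by blast
  qed
qed

section \<open>Cutting fans into short ones and replacing them by vertical segments\<close>

lemma fan_subdivide:
  assumes "0 < n"
  shows "fan \<beta> s t z \<subseteq> (\<Union>i<n. fan \<beta> (s + real i * ((t - s) / real n)) (s + real (Suc i) * ((t - s) / real n))
    (z + F (\<beta> - s) - F (\<beta> - (s + real i * ((t - s) / real n)))))"
proof
  fix p assume "p \<in> fan \<beta> s t z"
  then obtain x where x: "x \<in> {s..t}" and p: "p = (x, z + F (\<beta> - s) - F (\<beta> - x))"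
    unfolding fan_def by auto
  obtain i where "i < n" "x \<in> {s + real i * ((t - s) / real n)..s + real (Suc i) * ((t - s) / real n)}"
    using subdivide_interval[OF x assms] by blast
  then show "p \<in> (\<Union>i<n. fan \<beta> (s + real i * ((t - s) / real n)) (s + real (Suc i) * ((t - s) / real n))
    (z + F (\<beta> - s) - F (\<beta> - (s + real i * ((t - s) / real n)))))"
    unfolding fan_def p by force
qed

lemma subdivision_point_in_fan:
  assumes "i < n" "s \<le> t"
  shows "(s + real i * ((t - s) / real n), z + F (\<beta> - s) - F (\<beta> - (s + real i * ((t - s) / real n)))) \<in> fan \<beta> s t z"
proof -
  have "real i * (t - s) \<le> real n * (t - s)" using assms by (intro mult_right_mono) auto
  then have "real i * ((t - s) / real n) \<le> t - s" using assms by (simp add: field_simps)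
  then show ?thesis unfolding fan_def using assms by auto
qed

text \<open>Over \<open>{p..q}\<close> a subfan of length \<open>h\<close> reaches at most
  \<open>h * M\<close> above its starting translate, so a vertical segment of that height at the
  starting point covers its image. For small \<open>h\<close> these segments stay in
  \<open>U\<close>.\<close>

lemma fan_to_vsegs:
  assumes "q \<le> \<beta>" "s < t" "open U" "fan \<beta> s t z \<subseteq> U"
  obtains K where "vsegs K" "K \<subseteq> U" "\<And>\<alpha>. \<alpha> \<in> {p..q} \<Longrightarrow> Phi F \<alpha> ` fan \<beta> s t z \<subseteq> Phi F \<alpha> ` K"
proof -
  obtain e where e: "0 < e" "(\<Union>k\<in>fan \<beta> s t z. ball k e) \<subseteq> U"
    using compact_subset_open_imp_ball_epsilon_subset[OF compact_fan assms(3,4)] by blast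
  \<comment> \<open>By monotonicity of \<open>F'\<close>, this bounds
    \<open>F' (\<beta> - \<xi>) - F' (\<alpha> - \<xi>)\<close> for
    \<open>\<xi> \<in> {s..t}\<close> and \<open>\<alpha> \<in> {p..q}\<close>; adding 1 makes it
    positive.\<close>
  define M where "M = \<bar>F' (\<beta> - s) - F' (p - t)\<bar> + 1"
  have M: "0 < M" by (simp add: M_def)
  obtain n :: nat where n: "0 < n" "((t - s) * M) / real n \<le> e / 2"
    using ex_small_fraction[of "e / 2"] e(1) by auto
  define h where "h = (t - s) / real n"
  have "h * M \<le> e / 2" using n(2) by (simp add: h_def)
  then have "h * M < e" using e(1) by linarith
  then have h: "0 < h" "h * M < e" using n(1) assms(2) by (auto simp: h_def)
  define S where "S i = s + real i * h" for i
  define Z where "Z i = z + F (\<beta> - s) - F (\<beta> - S i)" for i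
  define V where "V i = {S i} \<times> {Z i..Z i + h * M}" for i
  show ?thesis
  proof (rule that[of "\<Union>i<n. V i"])
    show "vsegs (\<Union>i<n. V i)"
      unfolding V_def by (intro vsegs_UN) (auto simp: vsegs_vseg simp flip: vseg_simp)
    have "V i \<subseteq> U" if "i < n" for i
    proof -
      have "(S i, Z i) \<in> fan \<beta> s t z"
        using subdivision_point_in_fan[OF that, of s t z \<beta>] assms(2) by (simp add: S_def Z_def h_def)
      moreover have "V i \<subseteq> ball (S i, Z i) e"
        using h by (auto simp: V_def dist_Pair_Pair dist_real_def)
      ultimately show ?thesis using e(2) by blast
    qed
    then show "(\<Union>i<n. V i) \<subseteq> U" by blast
    fix \<alpha> assume \<alpha>: "\<alpha> \<in> {p..q}"
    have piece: "Phi F \<alpha> ` fan \<beta> (S i) (S (Suc i)) (Z i) \<subseteq> Phi F \<alpha> ` V i" if "i < n" for i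
    proof -
      have le: "S i \<le> S (Suc i)" using h by (simp add: S_def algebra_simps)
      have *: "S (Suc i) - S i = h" by (simp add: S_def algebra_simps)
      obtain \<xi> where \<xi>: "\<xi> \<in> {S i..S (Suc i)}" and
        eq: "(F (\<alpha> - S (Suc i)) - F (\<beta> - S (Suc i))) - (F (\<alpha> - S i) - F (\<beta> - S i)) = h * (F' (\<beta> - \<xi>) - F' (\<alpha> - \<xi>))"
        using increment_mvt[OF le, of \<alpha> \<beta>] * by metis
      have "real (Suc i) * h \<le> real n * h" using that h by (intro mult_right_mono) auto
      then have "S (Suc i) \<le> t" using n by (simp add: S_def h_def)
      moreover have "s \<le> S i" using h by (simp add: S_def)
      ultimately have "F' (\<beta> - \<xi>) - F' (\<alpha> - \<xi>) \<le> M"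
        using \<xi> \<alpha> mono_D[of "\<beta> - \<xi>" "\<beta> - s"] mono_D[of "p - t" "\<alpha> - \<xi>"] by (auto simp: M_def)
      then have "h * (F' (\<beta> - \<xi>) - F' (\<alpha> - \<xi>)) \<le> h * M" using h by (intro mult_left_mono) auto
      then show ?thesis
        using \<alpha> assms(1) le eq unfolding V_def
        by (subst Phi_image_fan) (auto simp: Phi_image_vseg)
    qed
    have "fan \<beta> s t z \<subseteq> (\<Union>i<n. fan \<beta> (S i) (S (Suc i)) (Z i))"
      using fan_subdivide[OF n(1)] by (simp add: S_def Z_def h_def)
    then show "Phi F \<alpha> ` fan \<beta> s t z \<subseteq> Phi F \<alpha> ` (\<Union>i<n. V i)"
      using piece by blast
  qed
qed

text \<open>Induction on the number \<open>k\<close> of steps of size \<delta> that suffice to reach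
  \<open>N\<close>. In one step the fan is thickened to \<open>O'\<close>, which settles the area up
  to \<open>\<beta>'\<close>; it is then cut into short fans over \<open>\<beta>'\<close> inside
  \<open>O'\<close>, to which the induction hypothesis applies. The gap between \<open>w\<close> and
  \<eta> pays for the thickening.\<close>

lemma sweep:
  assumes "q \<le> \<beta>" "s < t" "0 \<le> w" "w < \<eta>" "0 < \<delta>"
    and modulus: "\<And>x \<beta>1 \<beta>2. x \<in> {s..t} \<Longrightarrow> \<beta> \<le> \<beta>1 \<Longrightarrow> \<beta>1 \<le> N \<Longrightarrow> \<beta>1 \<le> \<beta>2 \<Longrightarrow> \<beta>2 \<le> \<beta>1 + \<delta> \<Longrightarrow>
      F' (\<beta>2 - x) - F' (\<beta>1 - x) \<le> w"
    and "N \<le> \<beta> + real k * \<delta>" "open U" "fan \<beta> s t z \<subseteq> U"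
  shows "\<exists>K. vsegs K \<and> K \<subseteq> U \<and> (\<forall>\<alpha>\<in>{p..q}. Phi F \<alpha> ` fan \<beta> s t z \<subseteq> Phi F \<alpha> ` K) \<and>
    emeasure lborel (strip F {\<beta>..N} K) \<le> ennreal ((N - \<beta>) * ((t - s) * \<eta>))"
  using assms(1,2) modulus assms(7-9)
proof (induction k arbitrary: \<beta> s t z U)
  case (0 \<beta> s t z U)
  obtain K where K: "vsegs K" "K \<subseteq> U" "\<And>\<alpha>. \<alpha> \<in> {p..q} \<Longrightarrow> Phi F \<alpha> ` fan \<beta> s t z \<subseteq> Phi F \<alpha> ` K"
    using fan_to_vsegs[OF 0(1,2,5,6)] by blast
  \<comment> \<open>With \<open>k = 0\<close> the hypothesis says \<open>N \<le> \<beta>\<close>, so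
    the strip is empty or lies on a single vertical line.\<close>
  have "emeasure lborel (strip F {\<beta>..N} K) \<le> 0"
  proof (cases "N = \<beta>")
    case True
    have "compact (strip F {\<beta>..\<beta>} K)"
      by (intro compact_strip cont vsegs_compact K) auto
    then have "compact (snd ` strip F {\<beta>..\<beta>} K)"
      by (intro compact_continuous_image continuous_intros)
    then obtain B where "snd ` strip F {\<beta>..\<beta>} K \<subseteq> cbox (-B) B"
      using compact_imp_bounded bounded_subset_cbox_symmetric by blast
    then have "Phi F \<beta> ` K \<subseteq> {-B..-B + 2 * max B 0}" by (force simp: strip_def)
    then have "emeasure lborel (strip F {\<beta>..\<beta>} K) \<le> ennreal ((\<beta> - \<beta>) * (2 * max B 0))"
      by (intro emeasure_strip_le cont vsegs_compact K exI[of _ "-B"]) auto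
    then show ?thesis using True by simp
  next
    case False
    then have "{\<beta>..N} = {}" using 0 by auto
    then show ?thesis by (simp only: strip_empty) simp
  qed
  then show ?case using K by (intro exI[of _ K]) auto
next
  case (Suc k \<beta> s t z U)
  show ?case
  proof (cases "\<beta> < N")
    case False
    \<comment> \<open>The sweep is already past \<open>N\<close>, and the induction hypothesis
      applies to the unchanged fan.\<close>
    then have "N \<le> \<beta> + real k * \<delta>" using assms(5) by (simp add: add_increasing2)
    then show ?thesis using Suc by blast
  next
    case True
    define \<beta>' where "\<beta>' = min (\<beta> + \<delta>) N"
    have \<beta>': "\<beta> < \<beta>'" "\<beta>' \<le> N" "\<beta>' \<le> \<beta> + \<delta>" "q \<le> \<beta>'" "N \<le> \<beta>' + real k * \<delta>"
      using True assms(5) Suc.prems(1,4) by (auto simp: \<beta>'_def algebra_simps min_def)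
    have "emeasure lborel (strip F {\<beta>..\<beta>'} (fan \<beta> s t z)) \<le> ennreal ((\<beta>' - \<beta>) * ((t - s) * w))"
      using \<beta>' Suc.prems(2) assms(3) by (intro fan_area Suc.prems(3)) auto
    also have "\<dots> < ennreal ((\<beta>' - \<beta>) * ((t - s) * \<eta>))"
      using \<beta>' Suc.prems(2) assms(3,4) by (intro ennreal_lessI) auto
    finally obtain O' where O: "open O'" "fan \<beta> s t z \<subseteq> O'" "O' \<subseteq> U"
      "emeasure lborel (strip F {\<beta>..\<beta>'} O') < ennreal ((\<beta>' - \<beta>) * ((t - s) * \<eta>))"
      using thicken_strip[OF cont _ compact_fan Suc.prems(6,5)] by blast
    \<comment> \<open>Fans over \<open>\<beta>'\<close> of length at most \<open>d\<close> that
      start on the old fan remain in \<open>O'\<close>, which controls the area over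
      \<open>{\<beta>..\<beta>'}\<close> from now on.\<close>
    obtain d where d: "0 < d" "\<And>s' t' z'. (s', z') \<in> fan \<beta> s t z \<Longrightarrow> t' \<le> s' + d \<Longrightarrow> fan \<beta>' s' t' z' \<subseteq> O'"
      using short_fan_subset[OF compact_fan O(2,1)] by blast
    obtain n :: nat where n: "0 < n" "(t - s) / real n \<le> d"
      using ex_small_fraction[OF d(1)] by auto
    define h where "h = (t - s) / real n"
    have h: "0 < h" "h \<le> d" using n Suc.prems(2) by (auto simp: h_def)
    define S where "S i = s + real i * h" for i
    define Z where "Z i = z + F (\<beta> - s) - F (\<beta> - S i)" for i
    have S: "S (Suc i) = S i + h" for i by (simp add: S_def algebra_simps)
    have "\<exists>K. vsegs K \<and> K \<subseteq> O' \<and> (\<forall>\<alpha>\<in>{p..q}. Phi F \<alpha> ` fan \<beta>' (S i) (S (Suc i)) (Z i) \<subseteq> Phi F \<alpha> ` K) \<and>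
      emeasure lborel (strip F {\<beta>'..N} K) \<le> ennreal ((N - \<beta>') * ((S (Suc i) - S i) * \<eta>))" if "i < n" for i
    proof (rule Suc.IH[OF \<beta>'(4) _ _ \<beta>'(5) O(1)])
      show "S i < S (Suc i)" using h by (simp add: S)
      have "(S i, Z i) \<in> fan \<beta> s t z"
        using subdivision_point_in_fan[OF that, of s t z \<beta>] Suc.prems(2) by (simp add: S_def Z_def h_def)
      then show "fan \<beta>' (S i) (S (Suc i)) (Z i) \<subseteq> O'" using h by (intro d(2)) (auto simp: S)
      have "real (Suc i) * h \<le> real n * h" using that h by (intro mult_right_mono) auto
      then have "S (Suc i) \<le> t" using n by (simp add: S_def h_def)
      moreover have "s \<le> S i" using h by (simp add: S_def)
      ultimately show "F' (\<beta>2 - x) - F' (\<beta>1 - x) \<le> w"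
        if "x \<in> {S i..S (Suc i)}" "\<beta>' \<le> \<beta>1" "\<beta>1 \<le> N" "\<beta>1 \<le> \<beta>2" "\<beta>2 \<le> \<beta>1 + \<delta>" for x \<beta>1 \<beta>2
        using that \<beta>' by (intro Suc.prems(3)) auto
    qed
    then obtain K where K: "\<And>i. i < n \<Longrightarrow> vsegs (K i)" "\<And>i. i < n \<Longrightarrow> K i \<subseteq> O'"
      "\<And>i \<alpha>. i < n \<Longrightarrow> \<alpha> \<in> {p..q} \<Longrightarrow> Phi F \<alpha> ` fan \<beta>' (S i) (S (Suc i)) (Z i) \<subseteq> Phi F \<alpha> ` K i"
      "\<And>i. i < n \<Longrightarrow> emeasure lborel (strip F {\<beta>'..N} (K i)) \<le> ennreal ((N - \<beta>') * (h * \<eta>))"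
      unfolding S add_diff_cancel_left' by metis
    let ?K = "\<Union>i<n. K i"
    have vK: "vsegs ?K" using K(1) by (intro vsegs_UN) auto
    show ?thesis
    proof (intro exI[of _ ?K] conjI ballI vK)
      have KO: "?K \<subseteq> O'" using K(2) by blast
      then show "?K \<subseteq> U" using O(3) by blast
      show "Phi F \<alpha> ` fan \<beta> s t z \<subseteq> Phi F \<alpha> ` ?K" if "\<alpha> \<in> {p..q}" for \<alpha>
      proof -
        have "fan \<beta> s t z \<subseteq> (\<Union>i<n. fan \<beta> (S i) (S (Suc i)) (Z i))"
          using fan_subdivide[OF n(1)] by (simp add: S_def Z_def h_def)
        moreover have "Phi F \<alpha> ` fan \<beta> (S i) (S (Suc i)) (Z i) \<subseteq> Phi F \<alpha> ` K i" if "i < n" for i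
        proof -
          have "Phi F \<alpha> ` fan \<beta> (S i) (S (Suc i)) (Z i) \<subseteq> Phi F \<alpha> ` fan \<beta>' (S i) (S (Suc i)) (Z i)"
            using \<open>\<alpha> \<in> {p..q}\<close> Suc.prems(1) \<beta>' h by (intro Phi_image_fan_mono) (auto simp: S)
          then show ?thesis using K(3)[OF that \<open>\<alpha> \<in> {p..q}\<close>] by blast
        qed
        ultimately show ?thesis by blast
      qed
      have bor: "strip F {\<beta>'..N} (K i) \<in> sets lborel" if "i < n" for i
        using that K(1) by (simp add: compact_strip_borel[OF cont] vsegs_compact)
      have "{\<beta>..N} = {\<beta>..\<beta>'} \<union> {\<beta>'..N}" using \<beta>' by auto
      then have "strip F {\<beta>..N} ?K \<subseteq> strip F {\<beta>..\<beta>'} O' \<union> (\<Union>i<n. strip F {\<beta>'..N} (K i))"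
        using strip_mono[OF order_refl KO, of F "{\<beta>..\<beta>'}"] by (auto simp: strip_Un_left strip_UN)
      then have "emeasure lborel (strip F {\<beta>..N} ?K)
        \<le> emeasure lborel (strip F {\<beta>..\<beta>'} O' \<union> (\<Union>i<n. strip F {\<beta>'..N} (K i)))"
        using bor strip_borel[OF cont O(1), of "{\<beta>..\<beta>'}"] by (intro emeasure_mono) auto
      also have "\<dots> \<le> emeasure lborel (strip F {\<beta>..\<beta>'} O') + emeasure lborel (\<Union>i<n. strip F {\<beta>'..N} (K i))"
        using bor strip_borel[OF cont O(1), of "{\<beta>..\<beta>'}"] by (intro emeasure_subadditive) auto
      also have "\<dots> \<le> ennreal ((\<beta>' - \<beta>) * ((t - s) * \<eta>)) + (\<Sum>i<n. ennreal ((N - \<beta>') * (h * \<eta>)))"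
        using O(4) K(4) bor
        by (intro add_mono order.trans[OF emeasure_subadditive_finite] sum_mono) (auto simp: less_imp_le)
      \<comment> \<open>The lengths \<open>h\<close> of the pieces add up to \<open>t - s\<close>,
        so cutting does not increase the total bound.\<close>
      also have "(\<Sum>i<n. ennreal ((N - \<beta>') * (h * \<eta>))) = ennreal ((N - \<beta>') * ((t - s) * \<eta>))"
        using n(1) \<beta>'(2) Suc.prems(2) assms(3,4) by (subst sum_ennreal) (auto simp: h_def)
      also have "ennreal ((\<beta>' - \<beta>) * ((t - s) * \<eta>)) + ennreal ((N - \<beta>') * ((t - s) * \<eta>)) =
        ennreal ((N - \<beta>) * ((t - s) * \<eta>))"
        using \<beta>'(1,2) Suc.prems(2) assms(3,4)
        by (subst ennreal_plus[symmetric]) (auto simp flip: distrib_right)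
      finally show "emeasure lborel (strip F {\<beta>..N} ?K) \<le> ennreal ((N - \<beta>) * ((t - s) * \<eta>))" .
    qed
  qed
qed

end

text \<open>\<open>A\<close> is the window over which coverage must persist, \<open>I\<close> the
  region over which the area is to be small. Allowing every open \<open>U\<close> is what makes such
  replacements iterable: a later one can be confined to a neighbourhood of an earlier one.\<close>

definition blind :: "(real \<Rightarrow> real) \<Rightarrow> real set \<Rightarrow> real set \<Rightarrow> bool" where
  "blind F A I \<longleftrightarrow> (\<forall>v U e. open U \<longrightarrow> vseg v \<subseteq> U \<longrightarrow> 0 < e \<longrightarrow>
    (\<exists>K. vsegs K \<and> K \<subseteq> U \<and> (\<forall>\<alpha>\<in>A. Phi F \<alpha> ` vseg v \<subseteq> Phi F \<alpha> ` K) \<and>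
      emeasure lborel (strip F I K) \<le> ennreal e))"

section \<open>Small area to the right of the window\<close>

context convex_curve begin

text \<open>The segment is cut into \<open>n\<close> pieces, each piece is replaced by a fan over a
  point \<beta> slightly right of \<open>q\<close>, and the fans are swept from \<beta> to
  \<open>N\<close>. The total length \<open>L\<close> of the fans is independent of
  \<open>n\<close>, so \<open>n\<close> can be taken large enough to keep the fans near the segment
  without raising the swept area.\<close>

lemma blind_right: "blind F {p..q} {q..N}"
  unfolding blind_def
proof (intro allI impI)
  fix v :: "real \<times> real \<times> real" and e :: real and U :: "(real \<times> real) set"
  assume U: "open U" "vseg v \<subseteq> U" and e: "0 < e"
  obtain x0 y1 y2 where v: "v = (x0, y1, y2)" by (cases v)
  show "\<exists>K. vsegs K \<and> K \<subseteq> U \<and> (\<forall>\<alpha>\<in>{p..q}. Phi F \<alpha> ` vseg v \<subseteq> Phi F \<alpha> ` K) \<and>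
      emeasure lborel (strip F {q..N} K) \<le> ennreal e"
  proof (cases "y1 \<le> y2")
    case False
    then show ?thesis by (intro exI[of _ "{}"]) (auto simp: v)
  next
    case True
    define H where "H = y2 - y1"
    have H: "0 \<le> H" using True by (simp add: H_def)
    \<comment> \<open>With this choice \<open>(\<beta> - q) * H < e / 2\<close>: over
      \<open>{q..\<beta>}\<close> the original segment is already cheap and only needs
      thickening.\<close>
    define \<beta> where "\<beta> = q + e / (2 * (H + 1))"
    have \<beta>: "q < \<beta>" using e H by (simp add: \<beta>_def)
    have "emeasure lborel (strip F {q..\<beta>} (vseg v)) \<le> ennreal ((\<beta> - q) * H)"
      using \<beta> H by (intro emeasure_strip_le cont compact_vseg) (auto simp: v Phi_image_vseg H_def)
    also have "\<dots> < ennreal (e / 2)"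
      using e H by (intro ennreal_lessI) (auto simp: \<beta>_def field_simps add_pos_nonneg)
    finally obtain O' where O: "open O'" "vseg v \<subseteq> O'" "O' \<subseteq> U"
      "emeasure lborel (strip F {q..\<beta>} O') < ennreal (e / 2)"
      using thicken_strip[OF cont _ compact_vseg U(2,1)] by blast
    have "continuous_on {x0..x0 + 1} (\<lambda>x. F' (\<beta> - x) - F' (q - x))"
      by (intro continuous_intros continuous_on_compose2[OF cont_deriv]) auto
    then have "\<exists>x1\<in>{x0..x0 + 1}. \<forall>x\<in>{x0..x0 + 1}. F' (\<beta> - x1) - F' (q - x1) \<le> F' (\<beta> - x) - F' (q - x)"
      by (intro continuous_attains_inf) auto
    then obtain x1 where x1: "\<And>x. x \<in> {x0..x0 + 1} \<Longrightarrow> F' (\<beta> - x1) - F' (q - x1) \<le> F' (\<beta> - x) - F' (q - x)"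
      by blast
    \<comment> \<open>The least spread per unit length, over \<open>q\<close>, of fans over \<beta>
      in the columns \<open>{x0..x0 + 1}\<close>. It is positive because \<open>F'\<close> is
      strictly increasing, and it is a lower bound over every \<open>\<alpha> \<le> q\<close> as
      well.\<close>
    define c where "c = F' (\<beta> - x1) - F' (q - x1)"
    have c: "0 < c" using strict_monoD[OF mono_deriv, of "q - x1" "\<beta> - x1"] \<beta> by (simp add: c_def)
    \<comment> \<open>A fan of length \<open>L / n\<close> then spreads by at least
      \<open>(H + 1) / n\<close>, which exceeds the height \<open>H / n\<close> of one piece; the
      added 1 keeps \<open>L\<close> positive for a degenerate segment.\<close>
    define L where "L = (H + 1) / c"
    have L: "0 < L" using H c by (simp add: L_def)
    \<comment> \<open>Chosen so that the sweep of all fans costs at most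
      \<open>\<bar>N - \<beta>\<bar> * (L * \<eta>) \<le> e / 2\<close>; the absolute value covers
      \<open>N < \<beta>\<close>.\<close>
    define \<eta> where "\<eta> = e / (2 * L * (\<bar>N - \<beta>\<bar> + 1))"
    have \<eta>: "0 < \<eta>" using e L by (simp add: \<eta>_def)
    \<comment> \<open>An upper bound for \<open>\<beta>2\<close> in the modulus condition below,
      where \<open>\<beta>1 \<le> N\<close> and the step \<delta> is at most 1.\<close>
    define b where "b = max N \<beta> + 1"
    have "uniformly_continuous_on {\<beta> - x0 - 1..b - x0} F'"
      by (intro compact_uniformly_continuous continuous_on_subset[OF cont_deriv]) auto
    then obtain d0 where d0: "0 < d0" "\<And>x y. x \<in> {\<beta> - x0 - 1..b - x0} \<Longrightarrow> y \<in> {\<beta> - x0 - 1..b - x0} \<Longrightarrow>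
      dist x y < d0 \<Longrightarrow> dist (F' x) (F' y) < \<eta> / 2"
      unfolding uniformly_continuous_on_def using \<eta> by (metis half_gt_zero)
    define \<delta> where "\<delta> = min 1 (d0 / 2)"
    have \<delta>: "0 < \<delta>" "\<delta> \<le> 1" "\<delta> < d0" using d0(1) by (auto simp: \<delta>_def)
    obtain k where k: "N \<le> \<beta> + real k * \<delta>"
    proof -
      obtain k :: nat where "(N - \<beta>) / \<delta> < real k" using reals_Archimedean2 by blast
      then show ?thesis using \<delta> by (intro that[of k]) (simp add: field_simps)
    qed
    obtain d where d: "0 < d" "\<And>s t z. (s, z) \<in> vseg v \<Longrightarrow> t \<le> s + d \<Longrightarrow> fan \<beta> s t z \<subseteq> O'"
      using short_fan_subset[OF compact_vseg O(2,1)] by blast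
    obtain n :: nat where n: "0 < n" "L / real n \<le> min d 1"
      using ex_small_fraction[of "min d 1"] d(1) by auto
    define l where "l = L / real n"
    have l: "0 < l" "l \<le> d" "l \<le> 1" using n L by (auto simp: l_def)
    define Y where "Y i = y1 + real i * (H / real n)" for i
    have Yin: "(x0, Y i) \<in> vseg v" if "i < n" for i
    proof -
      have "real i * H \<le> real n * H" using that H by (intro mult_right_mono) auto
      then have "real i * (H / real n) \<le> H" using n by (simp add: field_simps)
      then show ?thesis using H n by (simp add: v Y_def H_def)
    qed
    have "\<exists>K. vsegs K \<and> K \<subseteq> O' \<and> (\<forall>\<alpha>\<in>{p..q}. Phi F \<alpha> ` fan \<beta> x0 (x0 + l) (Y i) \<subseteq> Phi F \<alpha> ` K) \<and>
      emeasure lborel (strip F {\<beta>..N} K) \<le> ennreal ((N - \<beta>) * ((x0 + l - x0) * \<eta>))" if "i < n" for i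
    proof (rule sweep[OF _ _ _ _ \<delta>(1) _ k O(1), where w = "\<eta> / 2"])
      show "fan \<beta> x0 (x0 + l) (Y i) \<subseteq> O'" using Yin[OF that] l by (intro d(2)) auto
      fix x \<beta>1 \<beta>2
      assume *: "x \<in> {x0..x0 + l}" "\<beta> \<le> \<beta>1" "\<beta>1 \<le> N" "\<beta>1 \<le> \<beta>2" "\<beta>2 \<le> \<beta>1 + \<delta>"
      then have "dist (F' (\<beta>2 - x)) (F' (\<beta>1 - x)) < \<eta> / 2"
        using l \<delta> by (intro d0(2)) (auto simp: b_def dist_real_def)
      then show "F' (\<beta>2 - x) - F' (\<beta>1 - x) \<le> \<eta> / 2" unfolding dist_real_def by linarith
    qed (use \<beta> l \<eta> in auto)
    then obtain K where K: "\<And>i. i < n \<Longrightarrow> vsegs (K i)" "\<And>i. i < n \<Longrightarrow> K i \<subseteq> O'"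
      "\<And>i \<alpha>. i < n \<Longrightarrow> \<alpha> \<in> {p..q} \<Longrightarrow> Phi F \<alpha> ` fan \<beta> x0 (x0 + l) (Y i) \<subseteq> Phi F \<alpha> ` K i"
      "\<And>i. i < n \<Longrightarrow> emeasure lborel (strip F {\<beta>..N} (K i)) \<le> ennreal ((N - \<beta>) * (l * \<eta>))"
      unfolding add_diff_cancel_left' by metis
    let ?K = "\<Union>i<n. K i"
    have vK: "vsegs ?K" using K(1) by (intro vsegs_UN) auto
    show ?thesis
    proof (intro exI[of _ ?K] conjI ballI vK)
      have KO: "?K \<subseteq> O'" using K(2) by blast
      then show "?K \<subseteq> U" using O(3) by blast
      fix \<alpha> assume \<alpha>: "\<alpha> \<in> {p..q}"
      show "Phi F \<alpha> ` vseg v \<subseteq> Phi F \<alpha> ` ?K"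
      proof
        fix y assume "y \<in> Phi F \<alpha> ` vseg v"
        then have y: "y - F (\<alpha> - x0) \<in> {y1..y2}" by (auto simp: v Phi_image_vseg)
        then obtain i where i: "i < n" "y - F (\<alpha> - x0) \<in> {Y i..Y (Suc i)}"
          using subdivide_interval[OF y n(1)] unfolding Y_def H_def by blast
        obtain \<xi> where \<xi>: "\<xi> \<in> {x0..x0 + l}" and
          eq: "(F (\<alpha> - (x0 + l)) - F (\<beta> - (x0 + l))) - (F (\<alpha> - x0) - F (\<beta> - x0)) = l * (F' (\<beta> - \<xi>) - F' (\<alpha> - \<xi>))"
          using increment_mvt[of x0 "x0 + l" \<alpha> \<beta>] l by auto
        have "c \<le> F' (\<beta> - \<xi>) - F' (\<alpha> - \<xi>)"
          using x1[of \<xi>] \<xi> l \<alpha> mono_D[of "\<alpha> - \<xi>" "q - \<xi>"] by (auto simp: c_def)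
        then have "l * c \<le> l * (F' (\<beta> - \<xi>) - F' (\<alpha> - \<xi>))" using l by (intro mult_left_mono) auto
        also note eq[symmetric]
        finally have "l * c \<le> (F (\<alpha> - (x0 + l)) - F (\<beta> - (x0 + l))) - (F (\<alpha> - x0) - F (\<beta> - x0))" .
        moreover have "H / real n \<le> l * c" using c n by (simp add: l_def L_def divide_right_mono)
        moreover have "Y (Suc i) = Y i + H / real n" by (simp add: Y_def algebra_simps add_divide_distrib)
        ultimately have "y \<in> Phi F \<alpha> ` fan \<beta> x0 (x0 + l) (Y i)"
          using i(2) \<alpha> \<beta> l by (subst Phi_image_fan) auto
        then show "y \<in> Phi F \<alpha> ` ?K" using K(3)[OF i(1) \<alpha>] i(1) by blast
      qed
    next
      have KO: "?K \<subseteq> O'" using K(2) by blast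
      have bor: "strip F {\<beta>..N} (K i) \<in> sets lborel" if "i < n" for i
        using that K(1) by (simp add: compact_strip_borel[OF cont] vsegs_compact)
      have "{q..N} \<subseteq> {q..\<beta>} \<union> {\<beta>..N}" by auto
      then have "strip F {q..N} ?K \<subseteq> strip F {q..\<beta>} ?K \<union> strip F {\<beta>..N} ?K"
        unfolding strip_Un_left[symmetric] by (intro strip_mono) auto
      then have "strip F {q..N} ?K \<subseteq> strip F {q..\<beta>} O' \<union> (\<Union>i<n. strip F {\<beta>..N} (K i))"
        using strip_mono[OF order_refl KO, of F "{q..\<beta>}"] by (auto simp: strip_UN)
      then have "emeasure lborel (strip F {q..N} ?K)
        \<le> emeasure lborel (strip F {q..\<beta>} O' \<union> (\<Union>i<n. strip F {\<beta>..N} (K i)))"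
        using bor strip_borel[OF cont O(1), of "{q..\<beta>}"] by (intro emeasure_mono) auto
      also have "\<dots> \<le> emeasure lborel (strip F {q..\<beta>} O') + emeasure lborel (\<Union>i<n. strip F {\<beta>..N} (K i))"
        using bor strip_borel[OF cont O(1), of "{q..\<beta>}"] by (intro emeasure_subadditive) auto
      also have "\<dots> \<le> ennreal (e / 2) + (\<Sum>i<n. ennreal (\<bar>N - \<beta>\<bar> * (l * \<eta>)))"
      proof (intro add_mono order.trans[OF emeasure_subadditive_finite] sum_mono)
        fix i assume "i \<in> {..<n}"
        then have "emeasure lborel (strip F {\<beta>..N} (K i)) \<le> ennreal ((N - \<beta>) * (l * \<eta>))" using K(4) by auto
        also have "\<dots> \<le> ennreal (\<bar>N - \<beta>\<bar> * (l * \<eta>))"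
          using l \<eta> by (intro ennreal_leI mult_right_mono) auto
        finally show "emeasure lborel (strip F {\<beta>..N} (K i)) \<le> ennreal (\<bar>N - \<beta>\<bar> * (l * \<eta>))" .
      qed (use O(4) bor in \<open>auto simp: less_imp_le\<close>)
      also have "(\<Sum>i<n. ennreal (\<bar>N - \<beta>\<bar> * (l * \<eta>))) = ennreal (\<bar>N - \<beta>\<bar> * (L * \<eta>))"
        using n(1) L \<eta> by (subst sum_ennreal) (auto simp: l_def)
      also have "\<dots> \<le> ennreal (e / 2)"
      proof (rule ennreal_leI)
        have "a * (e / 2 / (a + 1)) \<le> e / 2" if "0 \<le> a" for a
          using that e by (simp add: field_simps)
        moreover have "L * \<eta> = e / 2 / (\<bar>N - \<beta>\<bar> + 1)" using L by (simp add: \<eta>_def)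
        ultimately show "\<bar>N - \<beta>\<bar> * (L * \<eta>) \<le> e / 2" by simp
      qed
      also have "ennreal (e / 2) + ennreal (e / 2) = ennreal e"
        using e by (subst ennreal_plus[symmetric]) auto
      finally show "emeasure lborel (strip F {q..N} ?K) \<le> ennreal e" by (simp add: add_left_mono)
    qed
  qed
qed

end

subsection \<open>Reflections and two-sided smallness\<close>

text \<open>An instance of the diagonal change of variables, whose Jacobian factor here has modulus
  one.\<close>

lemma emeasure_lborel_reflect:
  fixes c d :: real and A :: "(real \<times> real) set"
  assumes "\<bar>c\<bar> = 1" "\<bar>d\<bar> = 1" "A \<in> sets borel"
  shows "emeasure lborel ((\<lambda>p. (c * fst p, d * snd p)) -` A) = emeasure lborel A"
proof -
  let ?R = "\<lambda>p::real \<times> real. (c * fst p, d * snd p)"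
  let ?c = "\<lambda>j::real \<times> real. if j = (1, 0) then c else d"
  have B: "Basis = {(1, 0), (0, 1) :: real \<times> real}" by (auto simp: Basis_prod_def)
  have R: "?R = (\<lambda>x. 0 + (\<Sum>j\<in>Basis. (?c j * (x \<bullet> j)) *\<^sub>R j))"
    by (auto simp: B fun_eq_iff)
  have "lborel = density (distr lborel borel ?R) (\<lambda>_. (\<Prod>j\<in>Basis. \<bar>?c j\<bar>))"
    unfolding R using assms by (intro lborel_affine_euclidean) auto
  also have "(\<lambda>_::real \<times> real. ennreal (\<Prod>j\<in>Basis. \<bar>?c j\<bar>)) = (\<lambda>_. 1)"
    using assms by (simp add: B)
  finally have "lborel = distr lborel borel ?R" by (simp add: density_1)
  then have "emeasure lborel A = emeasure (distr lborel borel ?R) A" by simp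
  also have "\<dots> = emeasure lborel (?R -` A)"
    using assms(3)
    by (subst emeasure_distr) (auto intro!: borel_measurable_continuous_onI continuous_intros)
  finally show ?thesis by simp
qed

lemma vsegs_reflect:
  assumes "\<bar>c\<bar> = 1" "\<bar>d\<bar> = 1" "vsegs K"
  shows "vsegs ((\<lambda>p. (c * fst p, d * snd p)) ` K)"
proof -
  have "vsegs ((\<lambda>p. (c * fst p, d * snd p)) ` vseg v)" for v
  proof -
    obtain x y z where v: "v = (x, y, z)" by (cases v)
    have "(\<lambda>p. (c * fst p, d * snd p)) ` vseg v = {c * x} \<times> (*) d ` {y..z}"
      by (force simp: v)
    also have "\<dots> = (if d = 1 then vseg (c * x, y, z) else vseg (c * x, -z, -y))"
      using assms(2) by (auto simp: abs_if split: if_splits)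
    finally show ?thesis by (auto simp: vsegs_vseg simp del: vseg_simp)
  qed
  moreover obtain T where T: "finite T" "K = \<Union> (vseg ` T)" using assms(3) by (auto simp: vsegs_def)
  moreover have "(\<lambda>p. (c * fst p, d * snd p)) ` K = (\<Union>v\<in>T. (\<lambda>p. (c * fst p, d * snd p)) ` vseg v)"
    by (simp add: T(2) image_UN)
  ultimately show ?thesis by (auto intro: vsegs_UN simp del: vseg_simp)
qed

text \<open>The reflection \<open>R\<close> of the parameters conjugates the two curves:
  \<open>Phi G \<alpha> p = d * Phi F (c * \<alpha>) (R p)\<close>. Taking \<open>c = -1\<close>
  exchanges left and right of the window, and \<open>d = -1\<close> exchanges increasing and
  decreasing derivatives.\<close>

lemma blind_reflect:
  assumes c: "\<bar>c\<bar> = 1" and d: "\<bar>d\<bar> = 1" and F: "continuous_on UNIV F" and I: "compact I"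
    and blind: "blind (\<lambda>x. d * F (c * x)) A I"
  shows "blind F ((*) c ` A) ((*) c ` I)"
  unfolding blind_def
proof (intro allI impI)
  fix v and U :: "(real \<times> real) set" and e :: real
  assume U: "open U" "vseg v \<subseteq> U" and e: "0 < e"
  define R where "R = (\<lambda>p::real \<times> real. (c * fst p, d * snd p))"
  define G where "G = (\<lambda>x. d * F (c * x))"
  have cc: "c * c = 1" "d * d = 1" using c d by (auto simp: abs_if split: if_splits)
  then have cc': "c * (c * x) = x" "d * (d * x) = x" for x
    by (metis mult.assoc mult_1)+
  have RR: "R (R p) = p" for p by (simp add: R_def cc')
  have contR: "continuous_on UNIV R" unfolding R_def by (intro continuous_intros)
  have PhiG: "Phi G \<alpha> p = d * Phi F (c * \<alpha>) (R p)" for \<alpha> p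
    by (simp add: Phi_def G_def R_def algebra_simps cc')
  have PhiG': "Phi F (c * \<alpha>) p = d * Phi G \<alpha> (R p)" for \<alpha> p
    by (simp add: PhiG RR cc')
  obtain v' where v': "vseg v' = R ` vseg v"
  proof -
    obtain x y z where v: "v = (x, y, z)" by (cases v)
    have "R ` vseg v = {c * x} \<times> (*) d ` {y..z}" by (force simp: v R_def)
    also have "\<dots> = (if d = 1 then vseg (c * x, y, z) else vseg (c * x, -z, -y))"
      using d by (auto simp: abs_if split: if_splits)
    finally show ?thesis using that by (metis (full_types))
  qed
  have "open (R -` U)" by (intro open_vimage U contR)
  moreover have "vseg v' \<subseteq> R -` U" using U(2) by (auto simp: v' RR)
  ultimately obtain K where K: "vsegs K" "K \<subseteq> R -` U"
    "\<And>\<alpha>. \<alpha> \<in> A \<Longrightarrow> Phi G \<alpha> ` vseg v' \<subseteq> Phi G \<alpha> ` K" "emeasure lborel (strip G I K) \<le> ennreal e"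
    using blind e unfolding blind_def G_def by metis
  show "\<exists>K. vsegs K \<and> K \<subseteq> U \<and> (\<forall>\<alpha>\<in>(*) c ` A. Phi F \<alpha> ` vseg v \<subseteq> Phi F \<alpha> ` K) \<and>
      emeasure lborel (strip F ((*) c ` I) K) \<le> ennreal e"
  proof (intro exI[of _ "R ` K"] conjI ballI)
    show "vsegs (R ` K)" unfolding R_def by (rule vsegs_reflect[OF c d K(1)])
    show "R ` K \<subseteq> U" using K(2) by auto
    fix \<alpha> assume "\<alpha> \<in> (*) c ` A"
    then obtain \<alpha>' where \<alpha>: "\<alpha> = c * \<alpha>'" "\<alpha>' \<in> A" by auto
    have "Phi F \<alpha> ` vseg v = (*) d ` Phi G \<alpha>' ` vseg v'"
      by (simp add: v' \<alpha> PhiG image_image RR cc')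
    also have "\<dots> \<subseteq> (*) d ` Phi G \<alpha>' ` K" using K(3)[OF \<alpha>(2)] by (rule image_mono)
    also have "\<dots> = Phi F \<alpha> ` R ` K" by (simp add: \<alpha> PhiG image_image cc')
    finally show "Phi F \<alpha> ` vseg v \<subseteq> Phi F \<alpha> ` R ` K" .
  next
    have G: "continuous_on UNIV G"
      unfolding G_def by (intro continuous_intros continuous_on_compose2[OF F]) auto
    have sb: "strip G I K \<in> sets borel" by (intro compact_strip_borel G I vsegs_compact K)
    have "strip F ((*) c ` I) (R ` K) = R -` strip G I K"
    proof (intro set_eqI iffI)
      fix p assume "p \<in> strip F ((*) c ` I) (R ` K)"
      then obtain \<alpha> k where "\<alpha> \<in> I" "k \<in> K" "p = (c * \<alpha>, Phi F (c * \<alpha>) (R k))"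
        by (auto simp: strip_def)
      then show "p \<in> R -` strip G I K" by (auto simp: strip_def PhiG R_def cc')
    next
      fix p assume "p \<in> R -` strip G I K"
      then obtain \<alpha> k where *: "\<alpha> \<in> I" "k \<in> K" "R p = (\<alpha>, Phi G \<alpha> k)"
        by (auto simp: strip_def)
      then have "p = R (\<alpha>, Phi G \<alpha> k)" by (metis RR)
      then have "p = (c * \<alpha>, Phi F (c * \<alpha>) (R k))" by (simp add: R_def PhiG cc')
      then show "p \<in> strip F ((*) c ` I) (R ` K)" using * by (auto simp: strip_def)
    qed
    then show "emeasure lborel (strip F ((*) c ` I) (R ` K)) \<le> ennreal e"
      using K(4) emeasure_lborel_reflect[OF c d sb] by (simp add: R_def)
  qed
qed

text \<open>Segments are replaced one at a time, half of the area budget going to the newest segment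
  and half to all the others.\<close>

lemma blind_vsegs:
  assumes F: "continuous_on UNIV F" and I: "compact I" and blind: "blind F A I"
    and "open U" "vsegs L" "L \<subseteq> U" "0 < e"
  shows "\<exists>K. vsegs K \<and> K \<subseteq> U \<and> (\<forall>\<alpha>\<in>A. Phi F \<alpha> ` L \<subseteq> Phi F \<alpha> ` K) \<and>
    emeasure lborel (strip F I K) \<le> ennreal e"
proof -
  obtain T where "finite T" "L = \<Union> (vseg ` T)" using assms(5) by (auto simp: vsegs_def)
  then show ?thesis using assms(6,7)
  proof (induction T arbitrary: L e rule: finite_induct)
    case empty
    then show ?case by (intro exI[of _ "{}"]) auto
  next
    case (insert v T)
    obtain K1 where K1: "vsegs K1" "K1 \<subseteq> U" "\<And>\<alpha>. \<alpha> \<in> A \<Longrightarrow> Phi F \<alpha> ` \<Union> (vseg ` T) \<subseteq> Phi F \<alpha> ` K1"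
      "emeasure lborel (strip F I K1) \<le> ennreal (e / 2)"
      using insert.IH[of "\<Union> (vseg ` T)" "e / 2"] insert.prems by auto
    obtain K2 where K2: "vsegs K2" "K2 \<subseteq> U" "\<And>\<alpha>. \<alpha> \<in> A \<Longrightarrow> Phi F \<alpha> ` vseg v \<subseteq> Phi F \<alpha> ` K2"
      "emeasure lborel (strip F I K2) \<le> ennreal (e / 2)"
      using blind[unfolded blind_def, rule_format, of U v "e / 2"] insert.prems assms(4) by auto
    have "emeasure lborel (strip F I (K1 \<union> K2)) \<le> emeasure lborel (strip F I K1) + emeasure lborel (strip F I K2)"
      unfolding strip_Un
      by (intro emeasure_subadditive) (auto intro!: compact_strip_borel F I vsegs_compact K1 K2)
    also have "\<dots> \<le> ennreal (e / 2) + ennreal (e / 2)" by (intro add_mono K1 K2)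
    also have "\<dots> = ennreal e" using insert.prems by (subst ennreal_plus[symmetric]) auto
    finally have "emeasure lborel (strip F I (K1 \<union> K2)) \<le> ennreal e" .
    moreover have "Phi F \<alpha> ` L \<subseteq> Phi F \<alpha> ` (K1 \<union> K2)" if "\<alpha> \<in> A" for \<alpha>
    proof -
      have "L = vseg v \<union> \<Union> (vseg ` T)" using insert.prems(1) by (simp only: image_insert Union_insert)
      then show ?thesis using K1(3)[OF that] K2(3)[OF that] unfolding image_Un
        by (simp only: image_Un) (rule Un_least; rule le_supI2 le_supI1; assumption)
    qed
    moreover have "K1 \<union> K2 \<subseteq> U" using K1(2) K2(2) by (rule Un_least)
    ultimately show ?case
      using vsegs_Un[OF K1(1) K2(1)] by (intro exI[of _ "K1 \<union> K2"]) simp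
  qed
qed

text \<open>The two demands are met in succession: after the area over \<open>I\<close> has been
  made small, the result is thickened to \<open>O'\<close> and refined inside \<open>O'\<close> for
  \<open>J\<close>. The bound over \<open>I\<close> persists and the coverage inclusions
  compose.\<close>

lemma blind_Un:
  assumes F: "continuous_on UNIV F" and I: "compact I" "compact J"
    and blind: "blind F A I" "blind F A J"
  shows "blind F A (I \<union> J)"
  unfolding blind_def
proof (intro allI impI)
  fix v and U :: "(real \<times> real) set" and e :: real
  assume U: "open U" "vseg v \<subseteq> U" and e: "0 < e"
  obtain K1 where K1: "vsegs K1" "K1 \<subseteq> U" "\<And>\<alpha>. \<alpha> \<in> A \<Longrightarrow> Phi F \<alpha> ` vseg v \<subseteq> Phi F \<alpha> ` K1"
    "emeasure lborel (strip F I K1) \<le> ennreal (e / 4)"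
    using blind(1)[unfolded blind_def, rule_format, OF U, of "e / 4"] e by auto
  \<comment> \<open>Thickening requires a strict bound, hence the first replacement is made with
    \<open>e / 4\<close>.\<close>
  have "ennreal (e / 4) < ennreal (e / 2)" using e by (intro ennreal_lessI) auto
  with K1(4) have "emeasure lborel (strip F I K1) < ennreal (e / 2)" by (rule le_less_trans)
  then obtain O' where O: "open O'" "K1 \<subseteq> O'" "O' \<subseteq> U" "emeasure lborel (strip F I O') < ennreal (e / 2)"
    using thicken_strip[OF F I(1) vsegs_compact[OF K1(1)] K1(2) U(1)] by blast
  obtain K where K: "vsegs K" "K \<subseteq> O'" "\<And>\<alpha>. \<alpha> \<in> A \<Longrightarrow> Phi F \<alpha> ` K1 \<subseteq> Phi F \<alpha> ` K"
    "emeasure lborel (strip F J K) \<le> ennreal (e / 2)"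
    using blind_vsegs[OF F I(2) blind(2) O(1) K1(1) O(2), of "e / 2"] e by auto
  have bor: "strip F I O' \<in> sets borel" "strip F J K \<in> sets borel"
    using strip_borel[OF F O(1) borel_compact[OF I(1)]]
      compact_strip_borel[OF F I(2) vsegs_compact[OF K(1)]] by simp_all
  have "emeasure lborel (strip F (I \<union> J) K) \<le> emeasure lborel (strip F I O' \<union> strip F J K)"
    using strip_mono[OF order_refl K(2), of F I] bor by (intro emeasure_mono) (auto simp: strip_Un_left)
  also have "\<dots> \<le> emeasure lborel (strip F I O') + emeasure lborel (strip F J K)"
    using bor by (intro emeasure_subadditive) auto
  also have "\<dots> \<le> ennreal (e / 2) + ennreal (e / 2)" using O(4) K(4) by (intro add_mono) (auto simp: less_imp_le)
  also have "\<dots> = ennreal e" using e by (subst ennreal_plus[symmetric]) auto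
  finally show "\<exists>K. vsegs K \<and> K \<subseteq> U \<and> (\<forall>\<alpha>\<in>A. Phi F \<alpha> ` vseg v \<subseteq> Phi F \<alpha> ` K) \<and>
      emeasure lborel (strip F (I \<union> J) K) \<le> ennreal e"
    using K(1) subset_trans[OF K(2) O(3)] subset_trans[OF K1(3) K(3)]
    by (intro exI[of _ K]) simp
qed

text \<open>The left side is the right side for the curve \<open>F (-x)\<close>, whose derivative
  \<open>- F' (-x)\<close> is again strictly increasing, with window
  \<open>{-q..-p}\<close>.\<close>

lemma (in convex_curve) blind_both: "blind F {p..q} ({M..p} \<union> {q..N})"
proof (rule blind_Un[OF cont])
  interpret reflected: convex_curve "\<lambda>x. F (-x)" "\<lambda>x. - F' (-x)"
  proof
    show "((\<lambda>x. F (-x)) has_real_derivative - F' (-x)) (at x)" for x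
    proof -
      have "((\<lambda>x. -x) has_real_derivative -1) (at x)" by (auto intro!: derivative_eq_intros)
      from DERIV_chain2[where f = F and g = "\<lambda>x. -x", OF deriv this] show ?thesis by simp
    qed
    show "continuous_on UNIV (\<lambda>x. - F' (-x))"
      by (intro continuous_intros continuous_on_compose2[OF cont_deriv]) auto
    show "strict_mono (\<lambda>x. - F' (-x))"
      using mono_deriv by (auto simp: strict_mono_def)
  qed
  have "blind (\<lambda>x. 1 * F ((-1) * x)) {-q..-p} {-p..-M}"
    using reflected.blind_right[of "-q" "-p" "-M"] by simp
  then have "blind F ((*) (-1) ` {-q..-p}) ((*) (-1) ` {-p..-M})"
    by (intro blind_reflect[of "-1" 1] cont) auto
  then show "blind F {p..q} {M..p}" by simp
qed (auto intro: blind_right)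

lemma blind_both_monotone:
  assumes deriv: "\<And>x. (F has_real_derivative F' x) (at x)" and cont: "continuous_on UNIV F'"
    and mono: "strict_mono F' \<or> strict_mono (\<lambda>x. - F' x)"
  shows "blind F {p..q} ({M..p} \<union> {q..N})"
  using mono
proof
  assume "strict_mono F'"
  then interpret convex_curve F F' using deriv cont by unfold_locales
  show ?thesis by (rule blind_both)
next
  assume m: "strict_mono (\<lambda>x. - F' x)"
  interpret convex_curve "\<lambda>x. - F x" "\<lambda>x. - F' x"
    using deriv cont m by unfold_locales (auto intro!: derivative_eq_intros continuous_intros)
  have "continuous_on UNIV F"
    using assms(1) by (auto intro!: DERIV_isCont continuous_at_imp_continuous_on)
  moreover have "blind (\<lambda>x. (-1) * F (1 * x)) {p..q} ({M..p} \<union> {q..N})"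
    using blind_both by simp
  ultimately have "blind F ((*) 1 ` {p..q}) ((*) 1 ` ({M..p} \<union> {q..N}))"
    by (intro blind_reflect[of 1 "-1"] compact_Un) auto
  moreover have "(*) (1::real) = (\<lambda>x. x)" by auto
  ultimately show ?thesis by (simp only: image_ident)
qed

subsection \<open>Iterated refinement\<close>

text \<open>Isolates what the curve contributes to the limit construction: continuity, and small
  area on both sides of any window.\<close>

locale venetian =
  fixes F :: "real \<Rightarrow> real"
  assumes cont: "continuous_on UNIV F"
    and blind: "\<And>p q N. blind F {p..q} ({-N..p} \<union> {q..N})"
begin

text \<open>Sheared along the curve based at \<open>x0\<close>, the open set \<open>G\<close>
  becomes a countable union of closed boxes. Each box singles out a subsegment whose strip over the
  box's window lies in \<open>G\<close>; a blind near it costs little outside that window. The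
  budgets \<open>r X\<close> add up to at most \<open>e\<close>.\<close>

lemma refine_in_open:
  assumes U: "open U" "vseg v \<subseteq> U" and G: "open G" and e: "0 < e"
  obtains U' C where "open U'" "closure U' \<subseteq> U" "countable C" "\<And>c. c \<in> C \<Longrightarrow> vseg c \<subseteq> U'"
    "\<And>\<alpha> y. (\<alpha>, y) \<in> G \<Longrightarrow> y \<in> Phi F \<alpha> ` vseg v \<Longrightarrow> \<exists>c\<in>C. y \<in> Phi F \<alpha> ` vseg c"
    "emeasure lborel (strip F {-N..N} U' - G) \<le> ennreal e"
proof -
  obtain x0 y1 y2 where v: "v = (x0, y1, y2)" by (cases v)
  \<comment> \<open>Normality provides room for the closure; nested closures are needed later to
    keep limit points inside the open sets.\<close>
  obtain U0 where U0: "open U0" "vseg v \<subseteq> U0" "closure U0 \<subseteq> U"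
  proof -
    have "closed (vseg v)" by (rule compact_imp_closed) simp
    moreover have "closed (- U)" "vseg v \<inter> - U = {}" using U by auto
    ultimately obtain A B where AB: "open A" "open B" "vseg v \<subseteq> A" "- U \<subseteq> B" "A \<inter> B = {}"
      using separation_normal by metis
    then have "closure A \<subseteq> - B" by (intro closure_minimal) auto
    then show ?thesis using AB by (intro that[of A]) auto
  qed
  \<comment> \<open>\<open>(\<alpha>, u) \<in> G'\<close> says that the translate
    \<open>(x0, u)\<close> meets \<open>G\<close> over \<alpha>.\<close>
  define G' where "G' = (\<lambda>p. (fst p, snd p + F (fst p - x0))) -` G"
  have "open G'" unfolding G'_def
    by (intro open_vimage G continuous_intros continuous_on_compose2[OF cont]) auto
  then obtain D where D: "countable D" "D \<subseteq> Pow G'" "\<And>X. X \<in> D \<Longrightarrow> \<exists>a b. X = cbox a b" "\<Union>D = G'"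
    using open_countable_Union_open_cbox by blast
  define r where "r X = e * (1/2) ^ Suc (to_nat_on D X)" for X
  have r: "0 < r X" for X using e by (simp add: r_def)
  define cover where "cover X O' T \<longleftrightarrow> open O' \<and> O' \<subseteq> U0 \<and> finite T \<and> (\<forall>c\<in>T. vseg c \<subseteq> O') \<and>
      (\<forall>\<alpha> u. (\<alpha>, u) \<in> X \<longrightarrow> u \<in> {y1..y2} \<longrightarrow> (\<exists>c\<in>T. u + F (\<alpha> - x0) \<in> Phi F \<alpha> ` vseg c)) \<and>
      emeasure lborel (strip F {-N..N} O' - G) \<le> ennreal (r X)" for X O' T
  have "\<exists>O' T. cover X O' T" if X: "X \<in> D" for X
  proof -
    obtain p y q z where X_eq: "X = {p..q} \<times> {y..z}"
      using D(3)[OF X] by (metis cbox_Pair_eq cbox_interval surj_pair)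
    \<comment> \<open>The part of the segment with heights in the box, possibly empty.\<close>
    define w where "w = (x0, max y1 y, min y2 z)"
    have w: "vseg w \<subseteq> U0" using U0(2) by (auto simp: v w_def)
    have "X \<subseteq> G'" using D(2) X by blast
    then have XG: "(\<alpha>, u + F (\<alpha> - x0)) \<in> G" if "\<alpha> \<in> {p..q}" "u \<in> {y..z}" for \<alpha> u
      using that subsetD[of X G' "(\<alpha>, u)"] by (auto simp: X_eq G'_def)
    have "strip F {p..q} (vseg w) \<subseteq> G"
      by (auto simp: strip_def w_def intro!: XG)
    \<comment> \<open>Everything inside \<open>O1\<close> has its strip over \<open>{p..q}\<close>
      in \<open>G\<close>, so area outside \<open>G\<close> can only arise over
      \<open>?J\<close>.\<close>
    then obtain O1 where O1: "open O1" "vseg w \<subseteq> O1" "strip F {p..q} O1 \<subseteq> G"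
      using tube_strip[OF cont _ G] by (metis compact_Icc)
    let ?J = "{-N..p} \<union> {q..N}"
    have J: "compact ?J" by (intro compact_Un) auto
    obtain K where K: "vsegs K" "K \<subseteq> O1 \<inter> U0" "\<And>\<alpha>. \<alpha> \<in> {p..q} \<Longrightarrow> Phi F \<alpha> ` vseg w \<subseteq> Phi F \<alpha> ` K"
      "emeasure lborel (strip F ?J K) \<le> ennreal (r X / 2)"
      using blind[unfolded blind_def, rule_format, of "O1 \<inter> U0" w "r X / 2"] O1 w U0(1) r[of X]
      by (metis Int_greatest half_gt_zero open_Int)
    have "ennreal (r X / 2) < ennreal (r X)" using r[of X] by (intro ennreal_lessI) auto
    with K(4) have "emeasure lborel (strip F ?J K) < ennreal (r X)" by (rule le_less_trans)
    then obtain O' where O: "open O'" "K \<subseteq> O'" "O' \<subseteq> O1 \<inter> U0" "emeasure lborel (strip F ?J O') < ennreal (r X)"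
      using thicken_strip[OF cont J vsegs_compact[OF K(1)] K(2)] O1(1) U0(1) by (metis open_Int)
    obtain T where T: "finite T" "K = \<Union> (vseg ` T)" using K(1) by (auto simp: vsegs_def)
    show ?thesis unfolding cover_def
    proof (intro exI[of _ O'] exI[of _ T] conjI allI impI ballI T(1) O(1))
      show "O' \<subseteq> U0" using O(3) by blast
      show "vseg c \<subseteq> O'" if "c \<in> T" for c using that O(2) T(2) by blast
      show "\<exists>c\<in>T. u + F (\<alpha> - x0) \<in> Phi F \<alpha> ` vseg c" if "(\<alpha>, u) \<in> X" "u \<in> {y1..y2}" for \<alpha> u
      proof -
        have "u + F (\<alpha> - x0) \<in> Phi F \<alpha> ` vseg w" using that by (auto simp: w_def X_eq Phi_image_vseg)
        then have "u + F (\<alpha> - x0) \<in> Phi F \<alpha> ` K" using K(3)[of \<alpha>] that by (auto simp: X_eq)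
        then show ?thesis unfolding T(2) by blast
      qed
      have "strip F {p..q} O' \<subseteq> G" using O1(3) strip_mono[of "{p..q}" "{p..q}" O' O1 F] O(3) by auto
      moreover have "strip F {-N..N} O' \<subseteq> strip F {p..q} O' \<union> strip F ?J O'"
        unfolding strip_Un_left[symmetric] by (intro strip_mono) auto
      ultimately have "strip F {-N..N} O' - G \<subseteq> strip F ?J O'" by blast
      moreover have "strip F ?J O' \<in> sets borel" using J by (intro strip_borel cont O) (auto simp: borel_compact)
      ultimately have "emeasure lborel (strip F {-N..N} O' - G) \<le> emeasure lborel (strip F ?J O')"
        by (intro emeasure_mono) auto
      then show "emeasure lborel (strip F {-N..N} O' - G) \<le> ennreal (r X)" using O(4) by simp
    qed
  qed
  then obtain O' T where "\<And>X. X \<in> D \<Longrightarrow> cover X (O' X) (T X)" by metis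
  then have OT: "\<And>X. X \<in> D \<Longrightarrow> open (O' X)" "\<And>X. X \<in> D \<Longrightarrow> O' X \<subseteq> U0" "\<And>X. X \<in> D \<Longrightarrow> finite (T X)"
    "\<And>X c. X \<in> D \<Longrightarrow> c \<in> T X \<Longrightarrow> vseg c \<subseteq> O' X"
    "\<And>X \<alpha> u. X \<in> D \<Longrightarrow> (\<alpha>, u) \<in> X \<Longrightarrow> u \<in> {y1..y2} \<Longrightarrow> \<exists>c\<in>T X. u + F (\<alpha> - x0) \<in> Phi F \<alpha> ` vseg c"
    "\<And>X. X \<in> D \<Longrightarrow> emeasure lborel (strip F {-N..N} (O' X) - G) \<le> ennreal (r X)"
    by (simp_all add: cover_def)
  show ?thesis
  proof (rule that[of "\<Union>X\<in>D. O' X" "\<Union>X\<in>D. T X"])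
    show "open (\<Union>X\<in>D. O' X)" using OT(1) by blast
    have "(\<Union>X\<in>D. O' X) \<subseteq> U0" using OT(2) by blast
    then show "closure (\<Union>X\<in>D. O' X) \<subseteq> U" using closure_mono U0(3) by blast
    show "countable (\<Union>X\<in>D. T X)" using D(1) OT(3) by (auto intro: countable_finite)
    show "vseg c \<subseteq> (\<Union>X\<in>D. O' X)" if "c \<in> (\<Union>X\<in>D. T X)" for c using that OT(4) by blast
    show "\<exists>c\<in>\<Union>X\<in>D. T X. y \<in> Phi F \<alpha> ` vseg c" if "(\<alpha>, y) \<in> G" "y \<in> Phi F \<alpha> ` vseg v" for \<alpha> y
    proof -
      have "(\<alpha>, y - F (\<alpha> - x0)) \<in> G'" using that by (simp add: G'_def)
      then obtain X where X: "X \<in> D" "(\<alpha>, y - F (\<alpha> - x0)) \<in> X" using D(4) by blast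
      moreover have "y - F (\<alpha> - x0) \<in> {y1..y2}" using that by (auto simp: v Phi_image_vseg)
      ultimately show ?thesis using OT(5)[OF X] by auto
    qed
    have "strip F {-N..N} (\<Union>X\<in>D. O' X) - G = (\<Union>X\<in>D. strip F {-N..N} (O' X) - G)"
      by (auto simp: strip_UN)
    moreover have "emeasure lborel (\<Union>X\<in>D. strip F {-N..N} (O' X) - G) \<le> ennreal e"
      using D(1) e OT(1,6) G
      by (intro emeasure_countable_UN_le) (auto simp: r_def intro!: sets.Diff strip_borel cont)
    ultimately show "emeasure lborel (strip F {-N..N} (\<Union>X\<in>D. O' X) - G) \<le> ennreal e" by simp
  qed
qed

text \<open>A tree of segments with open neighbourhoods is grown, level \<open>k\<close> being
  refined against \<open>G k\<close> with total error at most \<open>(1/2) ^ k\<close>. Points of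
  all \<open>G k\<close> stay covered along a branch, and compactness gives a translate in the limit
  set; points outside some \<open>G k\<close> lie in error sets of areas tending to zero.\<close>

lemma limit_set:
  assumes U0: "open U0" "bounded U0" "vseg v0 \<subseteq> U0" and G: "\<And>k::nat. open (G k)" "decseq G"
  obtains E where "E \<subseteq> U0" "\<And>\<alpha> y. (\<alpha>, y) \<in> (\<Inter>k. G k) \<Longrightarrow> y \<in> Phi F \<alpha> ` vseg v0 \<Longrightarrow> y \<in> Phi F \<alpha> ` E"
    "\<exists>Z\<in>null_sets lborel. strip F {-N..N} E - (\<Inter>k. G k) \<subseteq> Z"
proof -
  define child where "child U v k e U' C \<longleftrightarrow> open U' \<and> closure U' \<subseteq> U \<and> countable C \<and>
      (\<forall>c\<in>C. vseg c \<subseteq> U') \<and>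
      (\<forall>\<alpha> y. (\<alpha>, y) \<in> G k \<longrightarrow> y \<in> Phi F \<alpha> ` vseg v \<longrightarrow> (\<exists>c\<in>C. y \<in> Phi F \<alpha> ` vseg c)) \<and>
      emeasure lborel (strip F {-N..N} U' - G k) \<le> ennreal e" for U v k e U' C
  have "\<forall>U v k e. \<exists>U' C. open U \<longrightarrow> vseg v \<subseteq> U \<longrightarrow> 0 < e \<longrightarrow> child U v k e U' C"
  proof (intro allI)
    fix U v k e
    show "\<exists>U' C. open U \<longrightarrow> vseg v \<subseteq> U \<longrightarrow> 0 < e \<longrightarrow> child U v k e U' C"
    proof (cases "open U \<and> vseg v \<subseteq> U \<and> 0 < e")
      case True
      then show ?thesis
        using refine_in_open[of U v "G k" e N, OF _ _ G(1)] unfolding child_def by metis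
    qed auto
  qed
  then obtain u C where child: "\<And>U v k e. open U \<Longrightarrow> vseg v \<subseteq> U \<Longrightarrow> 0 < e \<Longrightarrow>
      child U v k e (u U v k e) (C U v k e)"
    by metis
  \<comment> \<open>The weights along the enumeration of a level make the errors of level
    \<open>k\<close> sum to at most \<open>(1/2) ^ k\<close>.\<close>
  define err where "err k P n = (1/2::real) ^ k * (1/2) ^ Suc (to_nat_on P n)"
    for k :: nat and P :: "((real \<times> real) set \<times> real \<times> real \<times> real) set" and n
  have err: "0 < err k P n" for k P n by (simp add: err_def)
  \<comment> \<open>\<open>P k\<close> is level \<open>k\<close> of the tree. The children of a node
    share one refined open set and carry one segment each.\<close>
  define P where "P = rec_nat {(U0, v0)}
    (\<lambda>k Q. \<Union>n\<in>Q. {u (fst n) (snd n) k (err k Q n)} \<times> C (fst n) (snd n) k (err k Q n))"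
  have P0: "P 0 = {(U0, v0)}" by (simp add: P_def)
  define uu where "uu k n = u (fst n) (snd n) k (err k (P k) n)" for k n
  define cc where "cc k n = C (fst n) (snd n) k (err k (P k) n)" for k n
  have PS: "P (Suc k) = (\<Union>n\<in>P k. {uu k n} \<times> cc k n)" for k
    by (simp add: P_def uu_def cc_def)
  have good: "countable (P k) \<and> (\<forall>n\<in>P k. open (fst n) \<and> vseg (snd n) \<subseteq> fst n)" for k
  proof (induction k)
    case 0
    then show ?case using U0 by (simp add: P0)
  next
    case (Suc k)
    have "child (fst n) (snd n) k (err k (P k) n) (uu k n) (cc k n)" if "n \<in> P k" for n
      unfolding uu_def cc_def using Suc that by (intro child err) auto
    then have *: "open (uu k n) \<and> countable (cc k n) \<and> (\<forall>c\<in>cc k n. vseg c \<subseteq> uu k n)" if "n \<in> P k" for n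
      using that by (simp add: child_def)
    then have "countable (P (Suc k))" using Suc unfolding PS by (intro countable_UN countable_SIGMA) auto
    then show ?case using * unfolding PS by auto
  qed
  have ch: "child (fst n) (snd n) k (err k (P k) n) (uu k n) (cc k n)" if "n \<in> P k" for n k
    unfolding uu_def cc_def using good[of k] that by (intro child err) auto
  have chD: "open (uu k n)" "closure (uu k n) \<subseteq> fst n"
      "emeasure lborel (strip F {-N..N} (uu k n) - G k) \<le> ennreal (err k (P k) n)" if "n \<in> P k" for n k
    using ch[OF that] by (simp_all add: child_def)
  have ch_cover: "\<exists>c\<in>cc k n. y \<in> Phi F \<alpha> ` vseg c"
    if "n \<in> P k" "(\<alpha>, y) \<in> G k" "y \<in> Phi F \<alpha> ` vseg (snd n)" for n k \<alpha> y
    using ch[OF that(1)] that(2,3) unfolding child_def by blast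
  define E where "E = (\<Inter>k. \<Union>n\<in>P k. fst n)"
  show ?thesis
  proof (rule that[of E])
    have EP: "E \<subseteq> (\<Union>n\<in>P k. fst n)" for k unfolding E_def by (rule INT_lower) simp
    from EP[of 0] show "E \<subseteq> U0" by (simp add: P0)
    show "y \<in> Phi F \<alpha> ` E" if G_in: "(\<alpha>, y) \<in> (\<Inter>k. G k)" and y: "y \<in> Phi F \<alpha> ` vseg v0" for \<alpha> y
    proof -
      \<comment> \<open>For fixed \<open>(\<alpha>, y)\<close>, dependent choice follows a branch
        whose segments all still cover \<open>y\<close> and whose open sets shrink together with
        their closures.\<close>
      have "\<exists>n. \<forall>k. (n k \<in> P k \<and> y \<in> Phi F \<alpha> ` vseg (snd (n k))) \<and> closure (fst (n (Suc k))) \<subseteq> fst (n k)"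
      proof (rule dependent_nat_choice)
        show "\<exists>x. x \<in> P 0 \<and> y \<in> Phi F \<alpha> ` vseg (snd x)" using y by (auto simp: P0)
        fix x k assume x: "x \<in> P k \<and> y \<in> Phi F \<alpha> ` vseg (snd x)"
        then obtain c where c: "c \<in> cc k x" "y \<in> Phi F \<alpha> ` vseg c"
          using ch_cover[of x k \<alpha> y] G_in by blast
        have "(uu k x, c) \<in> P (Suc k)" unfolding PS using x c(1) by auto
        then show "\<exists>z. (z \<in> P (Suc k) \<and> y \<in> Phi F \<alpha> ` vseg (snd z)) \<and> closure (fst z) \<subseteq> fst x"
          using c(2) chD(2)[of x k] x by (intro exI[of _ "(uu k x, c)"]) (simp del: vseg_simp)
      qed
      then obtain n where n: "\<And>k. n k \<in> P k" "\<And>k. y \<in> Phi F \<alpha> ` vseg (snd (n k))"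
        "\<And>k. closure (fst (n (Suc k))) \<subseteq> fst (n k)" by blast
      have "\<forall>k. \<exists>w. w \<in> vseg (snd (n k)) \<and> Phi F \<alpha> w = y" using n(2) by blast
      then obtain w where w: "\<And>k. w k \<in> vseg (snd (n k))" "\<And>k. Phi F \<alpha> (w k) = y" by metis
      have dec: "decseq (\<lambda>k. fst (n k))"
        by (intro decseq_SucI subset_trans[OF closure_subset n(3)])
      have wn: "w j \<in> fst (n k)" if "k \<le> j" for j k
      proof (rule subsetD[OF decseqD[OF dec that]])
        show "w j \<in> fst (n j)" using w(1)[of j] good[of j] n(1)[of j] by blast
      qed
      have "fst (n 0) = U0" using n(1)[of 0] by (simp add: P0)
      then have "\<forall>j. w j \<in> closure U0" using wn[of 0] closure_subset[of U0] by auto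
      moreover have "seq_compact (closure U0)"
        using U0(2) by (simp add: compact_closure compact_imp_seq_compact)
      ultimately obtain l s where ls: "strict_mono s" "(w \<circ> s) \<longlonglongrightarrow> l"
        by (meson seq_compactE)
      \<comment> \<open>The limit lies in the closure of each set of the branch, hence in the
        preceding open set.\<close>
      have "l \<in> fst (n k)" for k
      proof -
        have "eventually (\<lambda>j. (w \<circ> s) j \<in> closure (fst (n (Suc k)))) sequentially"
        proof (rule eventually_sequentiallyI)
          fix j assume "Suc k \<le> j"
          then have "Suc k \<le> s j" using seq_suble[OF ls(1), of j] by linarith
          then show "(w \<circ> s) j \<in> closure (fst (n (Suc k)))" 
            using subsetD[OF closure_subset wn] by simp
        qed
        then have "l \<in> closure (fst (n (Suc k)))"
          using Lim_in_closed_set[OF closed_closure _ sequentially_bot ls(2)] by blast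
        then show ?thesis using n(3) by blast
      qed
      then have "l \<in> E" unfolding E_def using n(1) by blast
      moreover have "Phi F \<alpha> l = y"
      proof -
        have "continuous_on UNIV (Phi F \<alpha>)" unfolding Phi_def
          by (intro continuous_intros continuous_on_compose2[OF cont]) auto
        then have "(\<lambda>j. Phi F \<alpha> ((w \<circ> s) j)) \<longlonglongrightarrow> Phi F \<alpha> l"
          using ls(2) by (rule continuous_on_tendsto_compose) auto
        then show ?thesis using w(2) LIMSEQ_unique[OF tendsto_const] by (auto simp: o_def)
      qed
      ultimately show ?thesis by blast
    qed
    \<comment> \<open>The error sets: what the open sets of level \<open>Suc k\<close>, refined
      against \<open>G k\<close>, produce outside \<open>G k\<close>.\<close>
    define Z where "Z k = (\<Union>n\<in>P k. strip F {-N..N} (uu k n) - G k)" for k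
    have Zn: "strip F {-N..N} (uu k n) - G k \<in> sets lborel" if "n \<in> P k" for n k
      using strip_borel[OF cont chD(1)[OF that], of "{-N..N}"] G(1) by auto
    have Zs: "Z k \<in> sets lborel" for k
      unfolding Z_def using good Zn by (intro sets.countable_UN') auto
    have Ze: "emeasure lborel (Z k) \<le> ennreal ((1/2) ^ k)" for k
      unfolding Z_def
    proof (rule emeasure_countable_UN_le)
      show "emeasure lborel (strip F {-N..N} (uu k n) - G k) \<le> ennreal ((1/2) ^ k * (1/2) ^ Suc (to_nat_on (P k) n))"
        if "n \<in> P k" for n
        using chD(3)[OF that] by (simp only: err_def)
    qed (use good Zn in auto)
    show "\<exists>Z\<in>null_sets lborel. strip F {-N..N} E - (\<Inter>k. G k) \<subseteq> Z"
    \<comment> \<open>Missing \<open>G j\<close> means missing every later \<open>G k\<close>, so a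
      bad point lies in \<open>Z k\<close> for all \<open>k \<ge> j\<close>; each such tail
      intersection is null.\<close>
    proof (intro bexI[of _ "\<Union>j. \<Inter>k\<in>{j..}. Z k"])
      have "(\<Inter>k\<in>{j..}. Z k) \<in> null_sets lborel" for j
      proof (rule null_setsI)
        show s: "(\<Inter>k\<in>{j..}. Z k) \<in> sets lborel" by (rule sets.countable_INT') (use Zs in auto)
        have le: "emeasure lborel (\<Inter>k\<in>{j..}. Z k) \<le> ennreal ((1/2) ^ (k + j))" for k
          by (rule order.trans[OF emeasure_mono Ze[of "k + j"]]) (use Zs in auto)
        have "(\<lambda>k. (1/2::real) ^ (k + j)) \<longlonglongrightarrow> 0"
          by (rule LIMSEQ_ignore_initial_segment) (simp add: LIMSEQ_power_zero)
        then have "(\<lambda>k. ennreal ((1/2) ^ (k + j))) \<longlonglongrightarrow> ennreal 0" by (rule tendsto_ennrealI)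
        then have "emeasure lborel (\<Inter>k\<in>{j..}. Z k) \<le> ennreal 0"
          by (rule LIMSEQ_le_const) (use le in blast)
        then show "emeasure lborel (\<Inter>k\<in>{j..}. Z k) = 0" by simp
      qed
      then show "(\<Union>j. \<Inter>k\<in>{j..}. Z k) \<in> null_sets lborel" by (rule null_sets_UN)
      show "strip F {-N..N} E - (\<Inter>k. G k) \<subseteq> (\<Union>j. \<Inter>k\<in>{j..}. Z k)"
      proof (rule subsetI)
        fix p assume p: "p \<in> strip F {-N..N} E - (\<Inter>k. G k)"
        then obtain j where j: "p \<notin> G j" by blast
        have "p \<in> Z k" if "j \<le> k" for k
        proof -
          have "p \<notin> G k" using j decseqD[OF G(2) that] by blast
          moreover have "(\<Union>n\<in>P (Suc k). fst n) \<subseteq> (\<Union>n\<in>P k. uu k n)"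
            unfolding PS by (auto split: if_splits)
          then have "E \<subseteq> (\<Union>n\<in>P k. uu k n)" using EP by (rule subset_trans[rotated])
          then have "p \<in> strip F {-N..N} (\<Union>n\<in>P k. uu k n)"
            using p strip_mono[OF order_refl, of E _ F "{-N..N}"] by blast
          ultimately show ?thesis unfolding Z_def strip_UN by blast
        qed
        then show "p \<in> (\<Union>j. \<Inter>k\<in>{j..}. Z k)" by blast
      qed
    qed
  qed
qed

end

subsection \<open>Prescribed sections\<close>

text \<open>The derivative is continued with slope one on both sides, using the clamp
  \<open>c\<close> onto \<open>{a..b}\<close>, and then integrated with the constant fixed by the
  value at \<open>a\<close>.\<close>

lemma extend_C1_monotone:
  fixes f f' :: "real \<Rightarrow> real"
  assumes ab: "a < b"
    and deriv: "\<And>x. x \<in> {a..b} \<Longrightarrow> (f has_real_derivative f' x) (at x within {a..b})"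
    and cont: "continuous_on {a..b} f'" and mono: "strict_mono_on {a..b} f'"
  obtains F F' where "\<And>x. (F has_real_derivative F' x) (at x)" "continuous_on UNIV F'" "strict_mono F'"
    "\<And>x. x \<in> {a..b} \<Longrightarrow> F x = f x"
proof -
  define c where "c x = max a (min b x)" for x
  have c: "c x \<in> {a..b}" for x using ab by (auto simp: c_def)
  have contc: "continuous_on UNIV c" unfolding c_def by (intro continuous_intros)
  define h where "h x = f' (c x) + (x - c x)" for x
  have h: "continuous_on UNIV h"
    unfolding h_def by (intro continuous_intros continuous_on_compose2[OF cont contc] contc) (use c in auto)
  have hm: "strict_mono h"
  proof (rule strict_monoI)
    fix x y :: real assume "x < y"
    have "f' (c x) \<le> f' (c y)" using \<open>x < y\<close> c strict_mono_on_imp_mono_on[OF mono]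
      by (intro mono_onD[of "{a..b}" f']) (auto simp: c_def)
    moreover have "x - c x \<le> y - c y" using \<open>x < y\<close> ab by (auto simp: c_def max_def min_def)
    \<comment> \<open>Strictness comes from one of the two summands: if \<open>x - c x\<close> does
      not grow, the clamped points themselves differ.\<close>
    moreover have "f' (c x) < f' (c y)" if "x - c x = y - c y"
      using that \<open>x < y\<close> c by (intro strict_mono_onD[OF mono]) auto
    ultimately show "h x < h y" unfolding h_def by fastforce
  qed
  obtain F0 where F0: "\<And>x. (F0 has_real_derivative h x) (at x)"
  proof -
    have "\<exists>F. \<forall>x :: real. -\<infinity> < ereal x \<longrightarrow> ereal x < \<infinity> \<longrightarrow> (F has_vector_derivative h x) (at x)"
      using h by (intro einterval_antiderivative) (auto simp: continuous_on_eq_continuous_at)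
    then show ?thesis using that by (auto simp: has_real_derivative_iff_has_vector_derivative)
  qed
  define F where "F x = F0 x + (f a - F0 a)" for x
  have F: "(F has_real_derivative h x) (at x)" for x
    unfolding F_def using F0 by (auto intro!: derivative_eq_intros)
  have "F x = f x" if x: "x \<in> {a..b}" for x
  proof -
    have "((\<lambda>x. F x - f x) has_real_derivative 0) (at t within {a..b})" if "t \<in> {a..b}" for t
    proof -
      have "h t = f' t" using that by (simp add: h_def c_def)
      then show ?thesis
        using DERIV_diff[OF has_field_derivative_at_within[OF F[of t]] deriv[OF that]] by simp
    qed
    then have "\<exists>k. \<forall>x\<in>{a..b}. F x - f x = k"
      by (intro has_field_derivative_zero_constant) auto
    then have "F x - f x = F a - f a" using x ab by (metis atLeastAtMost_iff less_imp_le order_refl)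
    then show ?thesis by (simp add: F_def)
  qed
  then show ?thesis using that[OF F h hm] by blast
qed

theorem theorem1p2:
  fixes a b :: real and f f' :: "real \<Rightarrow> real" and W :: "real \<Rightarrow> real set"
  assumes "a < b"
    and "\<And>x. x \<in> {a..b} \<Longrightarrow> (f has_real_derivative f' x) (at x within {a..b})"
    and "continuous_on {a..b} f'"
    and "strict_mono_on {a..b} f' \<or> strict_antimono_on {a..b} f'"
    and "(\<Union>\<alpha>. {\<alpha>} \<times> W \<alpha>) \<in> sets lebesgue"
  shows "\<exists>E :: (real \<times> real) set. AE \<alpha> in lebesgue.
           W \<alpha> \<subseteq> Phi_image a b f \<alpha> E \<and> Phi_image a b f \<alpha> E - W \<alpha> \<in> null_sets lebesgue"
proof -
  obtain F F' where F: "\<And>x. (F has_real_derivative F' x) (at x)" "continuous_on UNIV F'"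
    "strict_mono F' \<or> strict_mono (\<lambda>x. - F' x)" and Ff: "\<And>x. x \<in> {a..b} \<Longrightarrow> F x = f x"
    using assms(4)
  proof
    assume "strict_mono_on {a..b} f'"
    then show thesis using extend_C1_monotone[OF assms(1-3)] that by metis
  next
    assume anti: "strict_antimono_on {a..b} f'"
    have "((\<lambda>x. - f x) has_real_derivative - f' x) (at x within {a..b})" if "x \<in> {a..b}" for x
      using assms(2)[OF that] by (rule DERIV_minus)
    moreover have "continuous_on {a..b} (\<lambda>x. - f' x)" using assms(3) by (rule continuous_on_minus)
    moreover have "strict_mono_on {a..b} (\<lambda>x. - f' x)"
      using anti by (auto simp: monotone_on_def)
    ultimately obtain F F' where *: "\<And>x. (F has_real_derivative F' x) (at x)" "continuous_on UNIV F'"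
      "strict_mono F'" "\<And>x. x \<in> {a..b} \<Longrightarrow> F x = - f x"
      using extend_C1_monotone[OF assms(1), of "\<lambda>x. - f x" "\<lambda>x. - f' x"] by metis
    show thesis
      using * by (intro that[of "\<lambda>x. - F x" "\<lambda>x. - F' x"]) (auto intro!: DERIV_minus continuous_on_minus)
  qed
  interpret venetian F
  proof
    show "continuous_on UNIV F"
      using F(1) by (auto intro!: DERIV_isCont continuous_at_imp_continuous_on)
    show "blind F {p..q} ({-N..p} \<union> {q..N})" for p q N by (rule blind_both_monotone[OF F])
  qed
  \<comment> \<open>The target is enlarged by a null set \<open>T\<close> to a countable
    intersection of open sets; \<open>T\<close> will only contribute null sections.\<close>
  obtain H T where H: "gdelta H" "T \<in> null_sets lebesgue" "(\<Union>\<alpha>. {\<alpha>} \<times> W \<alpha>) \<union> T = H"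
    using lebesgue_set_almost_gdelta[OF assms(5)] by metis
  from H(1) obtain Gs where Gs: "\<And>n::nat. open (Gs n)" "H = (\<Inter>n. Gs n)"
    by (auto elim: gdelta.cases)
  define G where "G k = (\<Inter>n\<le>k. Gs n)" for k
  have G: "open (G k)" for k unfolding G_def using Gs(1) by auto
  have G_dec: "decseq G" unfolding G_def by (intro decseq_SucI) auto
  have GH: "(\<Inter>k. G k) = H" unfolding G_def Gs(2) by auto
  \<comment> \<open>A quarter of the length: deviations of up to \<open>2 * r\<close> from the
    midpoint of \<open>{a..b}\<close> stay in \<open>{a..b}\<close>, one \<open>r\<close> being
    spent on the grid and one on the width of \<open>U0\<close>.\<close>
  define r where "r = (b - a) / 4"
  have r: "0 < r" using assms(1) by (simp add: r_def)
  define x0 where "x0 i = of_int i * r" for i :: int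
  define U0 where "U0 i n = {x0 i - r<..<x0 i + r} \<times> {- real n - 1<..<real n + 1}" for i and n :: nat
  \<comment> \<open>If the first coordinate of \<open>p\<close> is within \<open>r\<close> of
    \<open>x0 i\<close> and \<open>\<alpha> - fst p \<in> {a..b}\<close>, then
    \<open>\<bar>\<alpha>\<bar> \<le> N i\<close>; the window thus contains every \<alpha> for which
    \<open>E i n\<close> has a point in the domain.\<close>
  define N where "N i = \<bar>x0 i\<bar> + r + \<bar>a\<bar> + \<bar>b\<bar>" for i
  define v where "v i n = (x0 i, - real n, real n)" for i and n :: nat
  have "\<exists>E. E \<subseteq> U0 i n \<and> (\<forall>\<alpha> y. (\<alpha>, y) \<in> H \<longrightarrow> y \<in> Phi F \<alpha> ` vseg (v i n) \<longrightarrow> y \<in> Phi F \<alpha> ` E) \<and>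
    (\<exists>Z\<in>null_sets lborel. strip F {- N i..N i} E - H \<subseteq> Z)" for i n
  proof -
    have "open (U0 i n)" "bounded (U0 i n)" unfolding U0_def
      by (auto intro!: open_Times bounded_Times)
    moreover have "vseg (v i n) \<subseteq> U0 i n" using r by (auto simp: v_def U0_def)
    ultimately show ?thesis using limit_set[of "U0 i n" "v i n" G "N i", OF _ _ _ G G_dec, unfolded GH]
      by metis
  qed
  then obtain E Z where EZ: "\<And>i n. E i n \<subseteq> U0 i n"
    "\<And>i n \<alpha> y. (\<alpha>, y) \<in> H \<Longrightarrow> y \<in> Phi F \<alpha> ` vseg (v i n) \<Longrightarrow> y \<in> Phi F \<alpha> ` E i n"
    "\<And>i n. Z i n \<in> null_sets lborel" "\<And>i n. strip F {- N i..N i} (E i n) - H \<subseteq> Z i n"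
    by metis
  define X where "X = (\<Union>i n. E i n)"
  obtain T' where T': "T' \<in> null_sets lborel" "T \<subseteq> T'"
    using H(2) by (metis null_sets_completion_iff2)
  define Y where "Y = T' \<union> (\<Union>i n. Z i n)"
  have "Y \<in> null_sets lborel" unfolding Y_def
    using T'(1) EZ(3) by (intro null_sets.Un null_sets_UN') auto
  then have "AE p in lborel. p \<notin> Y" by (rule AE_not_in)
  then have "AE p in lborel \<Otimes>\<^sub>M lborel. p \<notin> Y" unfolding lborel_prod .
  \<comment> \<open>Fubini: almost every section of the null set \<open>Y\<close> is null.\<close>
  then have "AE \<alpha> in lborel. AE y in lborel. (\<alpha>, y) \<notin> Y" by (rule lborel_pair.AE_pair)
  then have ae: "AE \<alpha> in lebesgue. AE y in lborel. (\<alpha>, y) \<notin> Y" by (rule AE_completion)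
  \<comment> \<open>These inclusions hold for every \<alpha>; exceptional values enter only through
    the sections of \<open>Y\<close>.\<close>
  have key: "W \<alpha> \<subseteq> Phi_image a b f \<alpha> X \<and> Phi_image a b f \<alpha> X - W \<alpha> \<subseteq> Pair \<alpha> -` Y" for \<alpha>
  proof
    have Phi_eq: "Phi f \<alpha> p = Phi F \<alpha> p" if "p \<in> dom_Phi a b \<alpha>" for p
      using that by (auto simp: Phi_def dom_Phi_def Ff mem_Times_iff)
    show "W \<alpha> \<subseteq> Phi_image a b f \<alpha> X"
    proof
      fix y assume "y \<in> W \<alpha>"
      then have yH: "(\<alpha>, y) \<in> H" using H(3) by auto
      \<comment> \<open>The grid point just below \<open>\<alpha> - (a + b) / 2\<close>; every
        translate in the column around it then has \<alpha> in its domain.\<close>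
      define i where "i = \<lfloor>(\<alpha> - (a + b) / 2) / r\<rfloor>"
      have "of_int i \<le> (\<alpha> - (a + b) / 2) / r" "(\<alpha> - (a + b) / 2) / r < of_int i + 1"
        unfolding i_def by linarith+
      then have i: "x0 i \<le> \<alpha> - (a + b) / 2" "\<alpha> - (a + b) / 2 < x0 i + r"
        using r by (simp_all add: x0_def field_simps)
      obtain n :: nat where "\<bar>y - F (\<alpha> - x0 i)\<bar> \<le> real n" using real_arch_simple by blast
      then have "y \<in> Phi F \<alpha> ` vseg (v i n)" by (auto simp: v_def Phi_image_vseg)
      then obtain p where p: "p \<in> E i n" "y = Phi F \<alpha> p" using EZ(2)[OF yH] by blast
      have "fst p \<in> {x0 i - r<..<x0 i + r}" using subsetD[OF EZ(1) p(1)] by (auto simp: U0_def)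
      then have "p \<in> dom_Phi a b \<alpha>" using i by (auto simp: dom_Phi_def mem_Times_iff r_def field_simps)
      then show "y \<in> Phi_image a b f \<alpha> X"
        unfolding Phi_image_def X_def using p Phi_eq by (intro image_eqI[of _ _ p]) auto
    qed
    show "Phi_image a b f \<alpha> X - W \<alpha> \<subseteq> Pair \<alpha> -` Y"
    proof
      fix y assume y: "y \<in> Phi_image a b f \<alpha> X - W \<alpha>"
      then obtain p i n where p: "p \<in> dom_Phi a b \<alpha>" "p \<in> E i n" "y = Phi F \<alpha> p"
        unfolding Phi_image_def X_def using Phi_eq by auto
      show "y \<in> Pair \<alpha> -` Y"
      \<comment> \<open>An excess point comes either from enlarging the target to \<open>H\<close>
        or from the error sets of the construction.\<close>
      proof (cases "(\<alpha>, y) \<in> H")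
        case True
        then have "(\<alpha>, y) \<in> T" using H(3) y by blast
        then show ?thesis using T'(2) by (auto simp: Y_def)
      next
        case False
        have "fst p \<in> {x0 i - r<..<x0 i + r}" using subsetD[OF EZ(1) p(2)] by (auto simp: U0_def)
        moreover have "\<alpha> - fst p \<in> {a..b}" using p(1) by (auto simp: dom_Phi_def mem_Times_iff)
        ultimately have "\<alpha> \<in> {- N i..N i}" by (auto simp: N_def)
        then have "(\<alpha>, y) \<in> strip F {- N i..N i} (E i n)" using p by (auto simp: strip_def)
        then have "(\<alpha>, y) \<in> Z i n" using False EZ(4) by blast
        then show ?thesis by (auto simp: Y_def)
      qed
    qed
  qed
  show ?thesis
  proof (intro exI[of _ X], use ae in eventually_elim)
    case (elim \<alpha>)
    have "Pair \<alpha> -` Y \<in> null_sets lborel"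
    proof -
      have "Y \<in> sets (lborel \<Otimes>\<^sub>M lborel)" using \<open>Y \<in> null_sets lborel\<close> unfolding lborel_prod by blast
      then have "Pair \<alpha> -` Y \<in> sets lborel" by (rule sets_Pair1)
      then show ?thesis using elim AE_iff_null_sets[of "Pair \<alpha> -` Y" lborel] by simp
    qed
    then have "Phi_image a b f \<alpha> X - W \<alpha> \<in> null_sets lebesgue"
      using key[of \<alpha>] by (meson null_sets_completion_subset null_sets_completionI)
    then show ?case using key[of \<alpha>] by blast
  qed
qed

end
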